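(* Let $1\subset H\subset G$ be a chain of finite abelian groups, and let $T=\mathbb{Q}(H<G)(1-\chi_{(\emptyset,\{1\})})$ with projection $f:\mathbb{Q}(H<G)\to T$, $x\mapsto x(1-\chi_{(\emptyset,\{1\})})$. Let $I$ be the ideal of $T$ generated by the elements $f(\chi_{(A,\pi(A))}-\chi_{(gN,\pi(g)\pi(N))})$, where $A$ runs over the nonempty subsets of $G$, $N=n(A)$ and $g\in A$ (so $A\subset gN$). Then there is an isomorphism of rings $$\bigoplus_{N<G}\mathbb{Q}(G/N)\to \frac{\mathbb{Q}(H<G)(1-\chi_{(\emptyset,\{1\})})}{I},$$ where the unit element $e_N$ of $\mathbb{Q}(G/N)$ is sent to (the class of) $\prod_{\overline{N'}\in\mathcal{M}(G/N)}\big(f(\chi_{(N,\pi(N))})-f(\chi_{(N',\pi(N'))})\big)$.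
   Context: Choose isomorphisms $\phi:G\to\hat G$ and $\psi:H\to\hat H$ with the character groups; $\pi:G\to H$ is the surjective homomorphism $\psi^{-1}\circ\mathrm{res}\circ\phi$, where $\mathrm{res}:\hat G\to\hat H$ is restriction. $\mathbb{Q}(H<G)$ is the rational generalized character ring of the chain $1\subset H\subset G$, taken modulo the ideal spanned by the character $\chi_{(\emptyset,\emptyset)}$ of the glider $\mathbb{C}\supset0\supset\cdots$. It is the commutative $\mathbb{Q}$-algebra with basis the elements $\chi_{(A,\pi(A))}$ ($\emptyset\ne A\subset G$; irreducible gliders of essential length $2$) and $\chi_{(\emptyset,B)}$ ($\emptyset\neq B\subset H$; irreducible gliders of essential length $1$), with multiplication $$\chi_{(A,\pi(A))}\chi_{(B,\pi(B))}=\chi_{(AB,\pi(AB))}+\sum_{c\in\pi(AB)}(n_c-1)\chi_{(\emptyset,\{c\})},$$ $$\chi_{(A,\pi(A))}\chi_{(\emptyset,B)}=\sum_{h\in\pi(A)}\chi_{(\emptyset,Bh)},\qquad \chi_{(\emptyset,B)}\chi_{(\emptyset,C)}=\chi_{(\emptyset,BC)},$$ where $n_c=\#\{(h,h')\in\pi(A)\times\pi(B):hh'=c\}$, and unit $\chi_{(\{1\},\{1\})}$. The element $\chi_{(\emptyset,\{1\})}$ is an idempotent. For nonempty $A\subset G$, $n(A)$ is the unique idempotent among the powers $A^k=\{a_1\cdots a_k:a_i\in A\}$, $k\ge1$; it is a subgroup of $G$ and $A$ is contained in one of its cosets. $\mathcal{M}(G/N)$ is the set of minimal nontrivial subgroups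 of $G/N$; $N'$ is the subgroup of $G$ containing $N$ with $N'/N=\overline{N'}$. The notation $N<G$ means that $N$ runs over the proper subgroups of $G$, and the algebra $T$ is taken contracted at its zero element $f(\chi_{(G,\pi(G))})$, i.e. this element is set equal to $0$. *)

theory Defs
  imports "HOL-Algebra.QuotRing" Complex_Main
begin

section \<open>Algebras given by structure constants\<close>

definition chi :: "'b \<Rightarrow> 'b \<Rightarrow> rat"
  where "chi p = (\<lambda>q. if q = p then 1 else 0)"

text \<open>
  The \<open>\<rat>\<close>-algebra with finite basis \<open>B\<close>: a coefficient function \<open>x\<close> vanishing outside
  \<open>B\<close> stands for \<open>\<Sum>p\<in>B. x p * chi p\<close>, and \<open>c p q\<close> is the coefficient function of
  the product of the basis elements \<open>p\<close> and \<open>q\<close>.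
\<close>
definition structure_algebra ::
    "'b set \<Rightarrow> ('b \<Rightarrow> 'b \<Rightarrow> 'b \<Rightarrow> rat) \<Rightarrow> ('b \<Rightarrow> rat) \<Rightarrow> ('b \<Rightarrow> rat) ring"
  where "structure_algebra B c u =
    \<lparr>carrier = {x. \<forall>b. b \<notin> B \<longrightarrow> x b = 0},
     mult = (\<lambda>x y r. \<Sum>p\<in>B. \<Sum>q\<in>B. x p * y q * c p q r),
     one = u,
     zero = (\<lambda>r. 0),
     add = (\<lambda>x y r. x r + y r)\<rparr>"

text \<open>The rational group algebra of a finite group.\<close>
definition group_algebra :: "('b, 'm) monoid_scheme \<Rightarrow> ('b \<Rightarrow> rat) ring"
  where "group_algebra K =
    structure_algebra (carrier K) (\<lambda>p q. chi (p \<otimes>\<^bsub>K\<^esub> q)) (chi \<one>\<^bsub>K\<^esub>)"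

text \<open>Direct sum of a finite family of rings.\<close>
definition direct_sum_ring :: "'i set \<Rightarrow> ('i \<Rightarrow> ('b, 'm) ring_scheme) \<Rightarrow> ('i \<Rightarrow> 'b) ring"
  where "direct_sum_ring S R =
    \<lparr>carrier = (\<Pi>\<^sub>E i\<in>S. carrier (R i)),
     mult = (\<lambda>x y. \<lambda>i\<in>S. x i \<otimes>\<^bsub>R i\<^esub> y i),
     one = (\<lambda>i\<in>S. \<one>\<^bsub>R i\<^esub>),
     zero = (\<lambda>i\<in>S. \<zero>\<^bsub>R i\<^esub>),
     add = (\<lambda>x y. \<lambda>i\<in>S. x i \<oplus>\<^bsub>R i\<^esub> y i)\<rparr>"

definition component_unit :: "'i set \<Rightarrow> ('i \<Rightarrow> ('b, 'm) ring_scheme) \<Rightarrow> 'i \<Rightarrow> 'i \<Rightarrow> 'b"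
  where "component_unit S R j = (\<lambda>i\<in>S. if i = j then \<one>\<^bsub>R i\<^esub> else \<zero>\<^bsub>R i\<^esub>)"

text \<open>The ring \<open>R e\<close> with unit \<open>e\<close>, for an idempotent \<open>e\<close> of a commutative ring \<open>R\<close>.\<close>
definition corner_ring :: "'b ring \<Rightarrow> 'b \<Rightarrow> 'b ring"
  where "corner_ring R e = R\<lparr>carrier := (\<lambda>x. x \<otimes>\<^bsub>R\<^esub> e) ` carrier R, one := e\<rparr>"


section \<open>Characters and the homomorphism from \<open>G\<close> to \<open>H\<close>\<close>

definition nonzero_complex :: "complex monoid"
  where "nonzero_complex = \<lparr>carrier = - {0}, mult = (*), one = 1\<rparr>"

definition character_group :: "('a, 'm) monoid_scheme \<Rightarrow> ('a \<Rightarrow> complex) monoid"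
  where "character_group G =
    \<lparr>carrier = hom G nonzero_complex \<inter> extensional (carrier G),
     mult = (\<lambda>\<chi> \<chi>'. \<lambda>x\<in>carrier G. \<chi> x * \<chi>' x),
     one = (\<lambda>x\<in>carrier G. 1)\<rparr>"

definition dual_restriction ::
    "'a set \<Rightarrow> ('a \<Rightarrow> 'a \<Rightarrow> complex) \<Rightarrow> ('a \<Rightarrow> 'a \<Rightarrow> complex) \<Rightarrow> 'a \<Rightarrow> 'a"
  where "dual_restriction H \<phi> \<psi> x = inv_into H \<psi> (restrict (\<phi> x) H)"


section \<open>The generalized character ring of the chain\<close>

text \<open>
  The pair \<open>(A, \<pi> ` A)\<close> indexes the irreducible glider of essential length 2 given by \<open>A\<close>,
  and \<open>({}, B)\<close> the irreducible glider of essential length 1 given by \<open>B\<close>.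
\<close>
definition glider_basis ::
    "('a, 'm) monoid_scheme \<Rightarrow> 'a set \<Rightarrow> ('a \<Rightarrow> 'a) \<Rightarrow> ('a set \<times> 'a set) set"
  where "glider_basis G H \<pi> =
    {(A, \<pi> ` A) | A. A \<noteq> {} \<and> A \<subseteq> carrier G} \<union> {({}, B) | B. B \<noteq> {} \<and> B \<subseteq> H}"

definition product_count ::
    "('a, 'm) monoid_scheme \<Rightarrow> 'a set \<Rightarrow> 'a set \<Rightarrow> 'a \<Rightarrow> nat"
  where "product_count G X Y c = card {(h, h'). h \<in> X \<and> h' \<in> Y \<and> h \<otimes>\<^bsub>G\<^esub> h' = c}"

fun glider_mult ::
    "('a, 'm) monoid_scheme \<Rightarrow> ('a \<Rightarrow> 'a) \<Rightarrow> 'a set \<times> 'a set \<Rightarrow> 'a set \<times> 'a set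
      \<Rightarrow> 'a set \<times> 'a set \<Rightarrow> rat"
  where "glider_mult G \<pi> (A, A') (B, B') =
    (if A \<noteq> {} \<and> B \<noteq> {} then
       (\<lambda>r. chi (A <#>\<^bsub>G\<^esub> B, \<pi> ` (A <#>\<^bsub>G\<^esub> B)) r
          + (\<Sum>c\<in>\<pi> ` (A <#>\<^bsub>G\<^esub> B).
               (of_nat (product_count G (\<pi> ` A) (\<pi> ` B) c) - 1) * chi ({}, {c}) r))
     else if A \<noteq> {} then (\<lambda>r. \<Sum>h\<in>\<pi> ` A. chi ({}, B' #>\<^bsub>G\<^esub> h) r)
     else if B \<noteq> {} then (\<lambda>r. \<Sum>h\<in>\<pi> ` B. chi ({}, A' #>\<^bsub>G\<^esub> h) r)
     else chi ({}, A' <#>\<^bsub>G\<^esub> B'))"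

definition glider_ring ::
    "('a, 'm) monoid_scheme \<Rightarrow> 'a set \<Rightarrow> ('a \<Rightarrow> 'a) \<Rightarrow> ('a set \<times> 'a set \<Rightarrow> rat) ring"
  where "glider_ring G H \<pi> =
    structure_algebra (glider_basis G H \<pi>) (glider_mult G \<pi>) (chi ({\<one>\<^bsub>G\<^esub>}, {\<one>\<^bsub>G\<^esub>}))"

definition glider_idem ::
    "('a, 'm) monoid_scheme \<Rightarrow> 'a set \<Rightarrow> ('a \<Rightarrow> 'a) \<Rightarrow> 'a set \<times> 'a set \<Rightarrow> rat"
  where "glider_idem G H \<pi> =
    \<one>\<^bsub>glider_ring G H \<pi>\<^esub> \<ominus>\<^bsub>glider_ring G H \<pi>\<^esub> chi ({}, {\<one>\<^bsub>G\<^esub>})"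

definition glider_corner ::
    "('a, 'm) monoid_scheme \<Rightarrow> 'a set \<Rightarrow> ('a \<Rightarrow> 'a) \<Rightarrow> ('a set \<times> 'a set \<Rightarrow> rat) ring"
  where "glider_corner G H \<pi> = corner_ring (glider_ring G H \<pi>) (glider_idem G H \<pi>)"

text \<open>
  The ideal of the corner ring by which one divides in order to contract it, i.e. to set its zero
  element (in the sense of semigroup algebras) \<open>\<chi>\<^bsub>(G, \<pi> G)\<^esub> (1 - \<chi>\<^bsub>({}, {1})\<^esub>)\<close> equal to \<open>0\<close>.
\<close>
definition contraction_ideal ::
    "('a, 'm) monoid_scheme \<Rightarrow> 'a set \<Rightarrow> ('a \<Rightarrow> 'a) \<Rightarrow> ('a set \<times> 'a set \<Rightarrow> rat) set"
  where "contraction_ideal G H \<pi> =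
    Idl\<^bsub>glider_corner G H \<pi>\<^esub>
      {chi (carrier G, \<pi> ` carrier G) \<otimes>\<^bsub>glider_ring G H \<pi>\<^esub> glider_idem G H \<pi>}"

definition glider_T ::
    "('a, 'm) monoid_scheme \<Rightarrow> 'a set \<Rightarrow> ('a \<Rightarrow> 'a) \<Rightarrow> ('a set \<times> 'a set \<Rightarrow> rat) set ring"
  where "glider_T G H \<pi> = glider_corner G H \<pi> Quot contraction_ideal G H \<pi>"

definition glider_proj ::
    "('a, 'm) monoid_scheme \<Rightarrow> 'a set \<Rightarrow> ('a \<Rightarrow> 'a) \<Rightarrow> ('a set \<times> 'a set \<Rightarrow> rat)
      \<Rightarrow> ('a set \<times> 'a set \<Rightarrow> rat) set"
  where "glider_proj G H \<pi> x =
    contraction_ideal G H \<pi> +>\<^bsub>glider_corner G H \<pi>\<^esub>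
      (x \<otimes>\<^bsub>glider_ring G H \<pi>\<^esub> glider_idem G H \<pi>)"


section \<open>The ideal \<open>I\<close> and the minimal subgroups\<close>

primrec set_power :: "('a, 'm) monoid_scheme \<Rightarrow> 'a set \<Rightarrow> nat \<Rightarrow> 'a set"
  where
    "set_power G A 0 = {\<one>\<^bsub>G\<^esub>}"
  | "set_power G A (Suc k) = set_power G A k <#>\<^bsub>G\<^esub> A"

definition idempotent_power :: "('a, 'm) monoid_scheme \<Rightarrow> 'a set \<Rightarrow> 'a set"
  where "idempotent_power G A =
    (THE E. (\<exists>k\<ge>1. E = set_power G A k) \<and> E <#>\<^bsub>G\<^esub> E = E)"

definition glider_ideal ::
    "('a, 'm) monoid_scheme \<Rightarrow> 'a set \<Rightarrow> ('a \<Rightarrow> 'a) \<Rightarrow> ('a set \<times> 'a set \<Rightarrow> rat) set set"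
  where "glider_ideal G H \<pi> =
    Idl\<^bsub>glider_T G H \<pi>\<^esub>
      {glider_proj G H \<pi>
         (chi (A, \<pi> ` A) \<ominus>\<^bsub>glider_ring G H \<pi>\<^esub>
          chi (g <#\<^bsub>G\<^esub> N, \<pi> g <#\<^bsub>G\<^esub> (\<pi> ` N)))
       | A N g. A \<noteq> {} \<and> A \<subseteq> carrier G \<and> N = idempotent_power G A \<and> g \<in> A}"

definition proper_subgroups :: "('a, 'm) monoid_scheme \<Rightarrow> 'a set set"
  where "proper_subgroups G = {N. subgroup N G \<and> N \<noteq> carrier G}"

definition minimal_subgroups :: "('b, 'm) monoid_scheme \<Rightarrow> 'b set set"
  where "minimal_subgroups K =
    {M. subgroup M K \<and> M \<noteq> {\<one>\<^bsub>K\<^esub>} \<and>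
        (\<forall>L. subgroup L K \<and> L \<noteq> {\<one>\<^bsub>K\<^esub>} \<and> L \<subseteq> M \<longrightarrow> L = M)}"

text \<open>For a subgroup \<open>M\<close> of \<open>G Mod N\<close>, the subgroup \<open>N'\<close> of \<open>G\<close> containing \<open>N\<close> with \<open>N' / N = M\<close>.\<close>
definition subgroup_lift :: "('a, 'm) monoid_scheme \<Rightarrow> 'a set \<Rightarrow> 'a set set \<Rightarrow> 'a set"
  where "subgroup_lift G N M = {g \<in> carrier G. N #>\<^bsub>G\<^esub> g \<in> M}"

end

theory Submission
  imports Defs
begin

text \<open>
  Sending \<open>\<chi>\<^bsub>(A, \<pi>(A))\<^esub>\<close> to the pair of \<open>A\<close> and \<open>\<Sum>\<^bsub>h \<in> \<pi>(A)\<^esub> {h}\<close>, and \<open>\<chi>\<^bsub>(\<emptyset>, B)\<^esub>\<close> to the pair of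
  \<open>0\<close> and \<open>B\<close>, embeds the glider ring into the product of two copies of the semigroup algebra of
  nonempty subsets of \<open>G\<close>: the long part and the short part. The corner at \<open>1 - \<chi>\<^bsub>(\<emptyset>, {1})\<^esub>\<close> is the
  kernel of the short part, so the long part identifies it with the semigroup algebra of the
  nonempty subsets of \<open>G\<close>. For a subgroup \<open>L\<close>, sending \<open>A\<close> to the coset of \<open>L\<close> containing it, if
  there is one, and to \<open>0\<close> otherwise, is multiplicative, and it does not distinguish \<open>A\<close> from the
  coset hull \<open>g n(A)\<close>. Over all proper \<open>L\<close> this gives a homomorphism onto the direct sum of the
  \<open>\<rat>(G/L)\<close>. It is onto because the prescribed products map to the component units, and its kernel
  is generated by \<open>G\<close> and the differences \<open>A - g n(A)\<close>: modulo these an element is a combination of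
  proper cosets, whose coefficients vanish one after another by induction along inclusion.
\<close>

section \<open>Algebras given by structure constants\<close>

lemma sum_chi:
  assumes "finite B" and "p \<in> B"
  shows "(\<Sum>r\<in>B. chi p r * F r) = F p"
proof -
  have "(\<Sum>r\<in>B. chi p r * F r) = (\<Sum>r\<in>B. if r = p then F r else 0)"
    by (rule sum.cong) (auto simp: chi_def)
  then show ?thesis using assms by simp
qed

lemma structure_algebra_simps:
  "carrier (structure_algebra B c u) = {x. \<forall>b. b \<notin> B \<longrightarrow> x b = 0}"
  "x \<otimes>\<^bsub>structure_algebra B c u\<^esub> y = (\<lambda>r. \<Sum>p\<in>B. \<Sum>q\<in>B. x p * y q * c p q r)"
  "\<one>\<^bsub>structure_algebra B c u\<^esub> = u"
  "\<zero>\<^bsub>structure_algebra B c u\<^esub> = (\<lambda>r. 0)"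
  "x \<oplus>\<^bsub>structure_algebra B c u\<^esub> y = (\<lambda>r. x r + y r)"
  by (simp_all add: structure_algebra_def)

lemma structure_algebra_abelian_group: "abelian_group (structure_algebra B c u)"
proof (rule abelian_groupI)
  fix x assume "x \<in> carrier (structure_algebra B c u)"
  then show "\<exists>y\<in>carrier (structure_algebra B c u).
      y \<oplus>\<^bsub>structure_algebra B c u\<^esub> x = \<zero>\<^bsub>structure_algebra B c u\<^esub>"
    by (intro bexI[of _ "\<lambda>r. - x r"]) (auto simp: structure_algebra_simps)
qed (auto simp: structure_algebra_simps add_ac)

text \<open>Subtraction is defined through the additive inverse, a description operator; pointwise
  negation is an inverse, so uniqueness identifies the two.\<close>

lemma structure_algebra_minus:
  assumes "x \<in> carrier (structure_algebra B c u)" and "y \<in> carrier (structure_algebra B c u)"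
  shows "x \<ominus>\<^bsub>structure_algebra B c u\<^esub> y = (\<lambda>r. x r - y r)"
proof -
  interpret abelian_group "structure_algebra B c u" by (rule structure_algebra_abelian_group)
  have "(\<lambda>r. - y r) \<oplus>\<^bsub>structure_algebra B c u\<^esub> y = \<zero>\<^bsub>structure_algebra B c u\<^esub>"
    by (simp add: structure_algebra_simps)
  moreover have "(\<lambda>r. - y r) \<in> carrier (structure_algebra B c u)"
    using assms by (simp add: structure_algebra_simps)
  ultimately have "\<ominus>\<^bsub>structure_algebra B c u\<^esub> y = (\<lambda>r. - y r)"
    using assms by (metis minus_equality)
  then show ?thesis by (simp add: a_minus_def structure_algebra_simps)
qed

text \<open>Pairing with \<open>F\<close> is the linear functional with value \<open>F r\<close> at
  the basis element \<open>r\<close>. Exchanging finite sums reduces its value on a product to its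
  values on products of basis elements; associativity and the homomorphism criterion both rest on
  this.\<close>

lemma structure_algebra_pairing:
  "(\<Sum>r\<in>B. (\<Sum>p\<in>B. \<Sum>q\<in>B. x p * y q * c p q r) * F r) =
    (\<Sum>p\<in>B. \<Sum>q\<in>B. x p * y q * (\<Sum>r\<in>B. c p q r * F r :: rat))"
proof -
  have "(\<Sum>r\<in>B. (\<Sum>p\<in>B. \<Sum>q\<in>B. x p * y q * c p q r) * F r) =
      (\<Sum>r\<in>B. \<Sum>p\<in>B. \<Sum>q\<in>B. x p * y q * c p q r * F r)"
    by (simp add: sum_distrib_right)
  also have "\<dots> = (\<Sum>p\<in>B. \<Sum>r\<in>B. \<Sum>q\<in>B. x p * y q * c p q r * F r)"
    by (rule sum.swap)
  also have "\<dots> = (\<Sum>p\<in>B. \<Sum>q\<in>B. \<Sum>r\<in>B. x p * y q * c p q r * F r)"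
    by (intro sum.cong refl sum.swap)
  finally show ?thesis by (simp add: sum_distrib_left mult.assoc)
qed

text \<open>Additive and distributive laws are built into the bilinear formula, so the remaining
  axioms are tested on basis elements. For associativity both bracketings are expanded into triple
  sums over the basis and compared termwise.\<close>

lemma structure_algebra_cring:
  assumes B: "finite B"
    and u: "\<And>b. b \<notin> B \<Longrightarrow> u b = 0"
    and c: "\<And>p q b. p \<in> B \<Longrightarrow> q \<in> B \<Longrightarrow> b \<notin> B \<Longrightarrow> c p q b = 0"
    and comm: "\<And>p q r. p \<in> B \<Longrightarrow> q \<in> B \<Longrightarrow> c p q r = c q p r"
    and unit: "\<And>p r. p \<in> B \<Longrightarrow> (\<Sum>q\<in>B. u q * c q p r) = chi p r"
    and assoc: "\<And>p q s r. p \<in> B \<Longrightarrow> q \<in> B \<Longrightarrow> s \<in> B \<Longrightarrow>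
      (\<Sum>t\<in>B. c p q t * c t s r) = (\<Sum>t\<in>B. c q s t * c p t r)"
  shows "cring (structure_algebra B c u)" (is "cring ?R")
proof (rule cringI[OF structure_algebra_abelian_group])
  have cm: "x \<otimes>\<^bsub>?R\<^esub> y = y \<otimes>\<^bsub>?R\<^esub> x" for x y
  proof -
    have "(\<Sum>p\<in>B. \<Sum>q\<in>B. x p * y q * c p q r) = (\<Sum>p\<in>B. \<Sum>q\<in>B. y p * x q * c p q r)" for r
      by (subst sum.swap) (simp add: comm mult.commute cong: sum.cong)
    then show ?thesis by (simp add: structure_algebra_simps)
  qed
  show "comm_monoid ?R"
  proof (rule comm_monoidI)
    fix x y z
    assume "x \<in> carrier ?R" "y \<in> carrier ?R" "z \<in> carrier ?R"
    have L: "((x \<otimes>\<^bsub>?R\<^esub> y) \<otimes>\<^bsub>?R\<^esub> z) r =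
        (\<Sum>p\<in>B. \<Sum>q\<in>B. \<Sum>s\<in>B. x p * y q * z s * (\<Sum>t\<in>B. c p q t * c t s r))" for r
    proof -
      have "((x \<otimes>\<^bsub>?R\<^esub> y) \<otimes>\<^bsub>?R\<^esub> z) r =
          (\<Sum>t\<in>B. (\<Sum>p\<in>B. \<Sum>q\<in>B. x p * y q * c p q t) * (\<Sum>s\<in>B. z s * c t s r))"
        by (simp add: structure_algebra_simps sum_distrib_left mult.assoc)
      also have "\<dots> = (\<Sum>p\<in>B. \<Sum>q\<in>B. x p * y q * (\<Sum>t\<in>B. \<Sum>s\<in>B. c p q t * (z s * c t s r)))"
        by (subst structure_algebra_pairing) (simp add: sum_distrib_left)
      also have "\<dots> = (\<Sum>p\<in>B. \<Sum>q\<in>B. x p * y q * (\<Sum>s\<in>B. \<Sum>t\<in>B. c p q t * (z s * c t s r)))"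
        by (subst (3) sum.swap) simp
      finally show ?thesis by (simp add: sum_distrib_left mult_ac)
    qed
    have R: "(x \<otimes>\<^bsub>?R\<^esub> (y \<otimes>\<^bsub>?R\<^esub> z)) r =
        (\<Sum>p\<in>B. \<Sum>q\<in>B. \<Sum>s\<in>B. x p * y q * z s * (\<Sum>t\<in>B. c q s t * c p t r))" for r
    proof -
      have "(x \<otimes>\<^bsub>?R\<^esub> (y \<otimes>\<^bsub>?R\<^esub> z)) r =
          (\<Sum>p\<in>B. x p * (\<Sum>t\<in>B. (\<Sum>q\<in>B. \<Sum>s\<in>B. y q * z s * c q s t) * c p t r))"
        by (simp only: structure_algebra_simps mult.assoc sum_distrib_left[symmetric])
      then show ?thesis
        by (simp add: structure_algebra_pairing) (simp add: sum_distrib_left mult_ac)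
    qed
    show "x \<otimes>\<^bsub>?R\<^esub> y \<otimes>\<^bsub>?R\<^esub> z = x \<otimes>\<^bsub>?R\<^esub> (y \<otimes>\<^bsub>?R\<^esub> z)"
      by (rule ext) (simp add: L R assoc cong: sum.cong)
  next
    fix x assume x: "x \<in> carrier ?R"
    have "(\<one>\<^bsub>?R\<^esub> \<otimes>\<^bsub>?R\<^esub> x) r = x r" for r
    proof -
      have "(\<one>\<^bsub>?R\<^esub> \<otimes>\<^bsub>?R\<^esub> x) r = (\<Sum>q\<in>B. \<Sum>p\<in>B. u p * x q * c p q r)"
        by (subst sum.swap) (simp add: structure_algebra_simps)
      also have "\<dots> = (\<Sum>q\<in>B. x q * (\<Sum>p\<in>B. u p * c p q r))"
        by (simp add: sum_distrib_left mult_ac)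
      also have "\<dots> = (\<Sum>q\<in>B. if q = r then x q else 0)"
        by (rule sum.cong) (auto simp: unit chi_def)
      also have "\<dots> = x r" using B x by (simp add: structure_algebra_simps)
      finally show ?thesis .
    qed
    then show "\<one>\<^bsub>?R\<^esub> \<otimes>\<^bsub>?R\<^esub> x = x" by auto
  qed (use u c cm in \<open>auto simp: structure_algebra_simps\<close>)
qed (auto simp: structure_algebra_simps sum.distrib algebra_simps)

text \<open>\<open>m p\<close> is the image of the basis element \<open>p\<close>, and the map is
  its linear extension. Bilinearity on both sides leaves unit and multiplicativity to be checked on
  basis elements; the vanishing of \<open>m p\<close> outside \<open>B'\<close> puts the image into
  the carrier.\<close>

lemma structure_algebra_hom:
  assumes B: "finite B"
    and m: "\<And>p j. p \<in> B \<Longrightarrow> j \<notin> B' \<Longrightarrow> m p j = 0"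
    and u: "\<And>j. (\<Sum>p\<in>B. u p * m p j) = u' j"
    and mult: "\<And>p q j. p \<in> B \<Longrightarrow> q \<in> B \<Longrightarrow>
      (\<Sum>r\<in>B. c p q r * m r j) = (\<Sum>i\<in>B'. \<Sum>i'\<in>B'. m p i * m q i' * c' i i' j)"
  shows "(\<lambda>x j. \<Sum>p\<in>B. x p * m p j)
    \<in> ring_hom (structure_algebra B c u) (structure_algebra B' c' u')"
proof (rule ring_hom_memI)
  fix x y
  let ?h = "\<lambda>x j. \<Sum>p\<in>B. x p * m p j"
  \<comment> \<open>Everything is expanded into a fourfold sum; moving the target indices outward
    lets the sums over \<open>p\<close> and \<open>q\<close> factor into values of
    \<open>?h\<close>.\<close>
  have "(\<Sum>r\<in>B. (\<Sum>p\<in>B. \<Sum>q\<in>B. x p * y q * c p q r) * m r j) =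
      (\<Sum>i\<in>B'. \<Sum>i'\<in>B'. ?h x i * ?h y i' * c' i i' j)" for j
  proof -
    have "(\<Sum>r\<in>B. (\<Sum>p\<in>B. \<Sum>q\<in>B. x p * y q * c p q r) * m r j) =
        (\<Sum>p\<in>B. \<Sum>q\<in>B. x p * y q * (\<Sum>i\<in>B'. \<Sum>i'\<in>B'. m p i * m q i' * c' i i' j))"
      by (simp add: structure_algebra_pairing mult cong: sum.cong)
    also have "\<dots> = (\<Sum>p\<in>B. \<Sum>q\<in>B. \<Sum>i\<in>B'. \<Sum>i'\<in>B'. x p * m p i * (y q * m q i') * c' i i' j)"
      by (simp add: sum_distrib_left mult_ac)
    also have "\<dots> = (\<Sum>p\<in>B. \<Sum>i\<in>B'. \<Sum>q\<in>B. \<Sum>i'\<in>B'. x p * m p i * (y q * m q i') * c' i i' j)"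
      by (intro sum.cong refl sum.swap)
    also have "\<dots> = (\<Sum>i\<in>B'. \<Sum>p\<in>B. \<Sum>q\<in>B. \<Sum>i'\<in>B'. x p * m p i * (y q * m q i') * c' i i' j)"
      by (rule sum.swap)
    also have "\<dots> = (\<Sum>i\<in>B'. \<Sum>p\<in>B. \<Sum>i'\<in>B'. \<Sum>q\<in>B. x p * m p i * (y q * m q i') * c' i i' j)"
      by (intro sum.cong refl sum.swap)
    also have "\<dots> = (\<Sum>i\<in>B'. \<Sum>i'\<in>B'. \<Sum>p\<in>B. \<Sum>q\<in>B. x p * m p i * (y q * m q i') * c' i i' j)"
      by (intro sum.cong refl sum.swap)
    finally show ?thesis
      by (simp only: sum_product) (simp only: sum_distrib_right)
  qed
  then show "?h (x \<otimes>\<^bsub>structure_algebra B c u\<^esub> y) = ?h x \<otimes>\<^bsub>structure_algebra B' c' u'\<^esub> ?h y"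
    by (simp add: structure_algebra_simps)
qed (auto simp: structure_algebra_simps m u sum.distrib algebra_simps)

text \<open>Stated for commutative monoids, since it serves both the quotients
  \<open>G Mod L\<close> and the monoid of nonempty subsets of \<open>G\<close>.\<close>

lemma group_algebra_cring:
  assumes "comm_monoid K" and fin: "finite (carrier K)"
  shows "cring (group_algebra K)"
  unfolding group_algebra_def
proof (rule structure_algebra_cring[OF fin])
  interpret comm_monoid K by fact
  show "chi \<one>\<^bsub>K\<^esub> b = 0" if "b \<notin> carrier K" for b
    using that by (auto simp: chi_def)
  show "chi (p \<otimes>\<^bsub>K\<^esub> q) b = 0" if "p \<in> carrier K" "q \<in> carrier K" "b \<notin> carrier K" for p q b
    using that by (auto simp: chi_def)
  show "chi (p \<otimes>\<^bsub>K\<^esub> q) r = chi (q \<otimes>\<^bsub>K\<^esub> p) r" if "p \<in> carrier K" "q \<in> carrier K" for p q r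
    using that by (simp add: m_comm)
  show "(\<Sum>q\<in>carrier K. chi \<one>\<^bsub>K\<^esub> q * chi (q \<otimes>\<^bsub>K\<^esub> p) r) = chi p r" if "p \<in> carrier K" for p r
    using that by (simp add: sum_chi[OF fin])
  show "(\<Sum>t\<in>carrier K. chi (p \<otimes>\<^bsub>K\<^esub> q) t * chi (t \<otimes>\<^bsub>K\<^esub> s) r) =
      (\<Sum>t\<in>carrier K. chi (q \<otimes>\<^bsub>K\<^esub> s) t * chi (p \<otimes>\<^bsub>K\<^esub> t) r)"
    if "p \<in> carrier K" "q \<in> carrier K" "s \<in> carrier K" for p q s r
    using that by (simp add: sum_chi[OF fin] m_assoc)
qed

section \<open>Transfer of ring laws, and the isomorphism theorem for an iterated quotient\<close>

text \<open>Each ring law becomes true after applying \<open>f\<close>, and injectivity pulls it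
  back. This later gives the corner its ring structure without a direct proof that the glider
  multiplication is associative.\<close>

lemma cring_if_inj_hom:
  assumes S: "cring S"
    and closed: "\<And>x y. x \<in> carrier R \<Longrightarrow> y \<in> carrier R \<Longrightarrow> x \<otimes>\<^bsub>R\<^esub> y \<in> carrier R"
      "\<And>x y. x \<in> carrier R \<Longrightarrow> y \<in> carrier R \<Longrightarrow> x \<oplus>\<^bsub>R\<^esub> y \<in> carrier R"
      "\<one>\<^bsub>R\<^esub> \<in> carrier R" "\<zero>\<^bsub>R\<^esub> \<in> carrier R"
    and neg: "\<And>x. x \<in> carrier R \<Longrightarrow> \<exists>y\<in>carrier R. y \<oplus>\<^bsub>R\<^esub> x = \<zero>\<^bsub>R\<^esub>"
    and f: "f \<in> ring_hom R S" "f \<zero>\<^bsub>R\<^esub> = \<zero>\<^bsub>S\<^esub>"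
    and inj: "inj_on f (carrier R)"
  shows "cring R"
proof -
  interpret S: cring S by fact
  note f' = ring_hom_mult[OF f(1)] ring_hom_add[OF f(1)] ring_hom_one[OF f(1)] f(2)
    ring_hom_closed[OF f(1)]
  note eqI = inj_onD[OF inj]
  show ?thesis
  proof (rule cringI)
    show "abelian_group R"
      by (rule abelian_groupI) (auto intro!: eqI closed neg simp: f' closed S.a_ac)
    show "comm_monoid R"
      by (rule comm_monoidI) (auto intro!: eqI closed simp: f' closed S.m_ac)
    show "(x \<oplus>\<^bsub>R\<^esub> y) \<otimes>\<^bsub>R\<^esub> z = x \<otimes>\<^bsub>R\<^esub> z \<oplus>\<^bsub>R\<^esub> y \<otimes>\<^bsub>R\<^esub> z"
      if "x \<in> carrier R" "y \<in> carrier R" "z \<in> carrier R" for x y z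
      using that by (auto intro!: eqI closed simp: f' closed S.l_distr)
  qed
qed

text \<open>The isomorphism theorem, directed from the image to the quotient: by \<open>ker\<close>,
  \<open>\<theta>\<close> and the double projection \<open>q\<close> have the same fibres, so an
  element of \<open>D\<close> may be lifted arbitrarily and then projected.\<close>

lemma double_quotient_iso:
  assumes R: "ring R" and J: "ideal J R" and I: "ideal I (R Quot J)"
    and \<theta>: "\<theta> \<in> ring_hom R D" and surj: "carrier D \<subseteq> \<theta> ` carrier R"
    and ker: "\<And>x y. x \<in> carrier R \<Longrightarrow> y \<in> carrier R \<Longrightarrow>
      \<theta> x = \<theta> y \<longleftrightarrow> J +>\<^bsub>R\<^esub> (x \<ominus>\<^bsub>R\<^esub> y) \<in> I"
  shows "\<exists>\<Phi> \<in> ring_iso D (R Quot J Quot I).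
    \<forall>x\<in>carrier R. \<Phi> (\<theta> x) = I +>\<^bsub>R Quot J\<^esub> (J +>\<^bsub>R\<^esub> x)"
proof -
  interpret R: ring R by fact
  interpret J: ideal J R by fact
  interpret T: ring "R Quot J" by (rule J.quotient_is_ring)
  interpret I: ideal I "R Quot J" by fact
  interpret p: ring_hom_ring R "R Quot J" "(+>\<^bsub>R\<^esub>) J" by (rule J.rcos_ring_hom_ring)
  define q where "q x = I +>\<^bsub>R Quot J\<^esub> (J +>\<^bsub>R\<^esub> x)" for x
  have q: "q \<in> ring_hom R (R Quot J Quot I)"
    using ring_hom_trans[OF J.rcos_ring_hom I.rcos_ring_hom] by (simp add: q_def[abs_def] comp_def)
  have q_eq: "q x = q y \<longleftrightarrow> \<theta> x = \<theta> y" if "x \<in> carrier R" "y \<in> carrier R" for x y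
  proof -
    \<comment> \<open>The class of the difference is the difference of the classes, which lies in
      \<open>I\<close> exactly when the classes agree modulo \<open>I\<close>; so \<open>ker\<close>
      becomes equality of values of \<open>q\<close>.\<close>
    have "J +>\<^bsub>R\<^esub> (x \<ominus>\<^bsub>R\<^esub> y) = (J +>\<^bsub>R\<^esub> x) \<ominus>\<^bsub>R Quot J\<^esub> (J +>\<^bsub>R\<^esub> y)"
      using that by (simp add: a_minus_def)
    then show ?thesis
      unfolding q_def ker[OF that]
      using T.quotient_eq_iff_same_a_r_cos[OF I] that p.hom_closed by metis
  qed
  define s where "s d = (SOME x. x \<in> carrier R \<and> \<theta> x = d)" for d
  have s: "s d \<in> carrier R" "\<theta> (s d) = d" if "d \<in> carrier D" for d
  proof -
    have "\<exists>x. x \<in> carrier R \<and> \<theta> x = d" using surj that by auto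
    from someI_ex[OF this] show "s d \<in> carrier R" "\<theta> (s d) = d" by (simp_all add: s_def)
  qed
  have \<theta>c: "\<theta> x \<in> carrier D" if "x \<in> carrier R" for x using \<theta> that by (rule ring_hom_closed)
  \<comment> \<open>The value of \<open>q\<close> does not depend on the lift chosen by
    \<open>s\<close>; hence all laws for \<open>q \<circ> s\<close> can be checked on elements of
    the form \<open>\<theta> a\<close>.\<close>
  have key: "q (s (\<theta> x)) = q x" if "x \<in> carrier R" for x
    using that s[OF \<theta>c[OF that]] by (simp add: q_eq)
  have img: "\<exists>x\<in>carrier R. d = \<theta> x" if "d \<in> carrier D" for d
    using s[OF that] by metis
  have "(q \<circ> s) \<in> ring_iso D (R Quot J Quot I)"
  proof (rule ring_iso_memI)
    show "(q \<circ> s) x \<in> carrier (R Quot J Quot I)" if "x \<in> carrier D" for x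
      using s[OF that] ring_hom_closed[OF q] by simp
    show "(q \<circ> s) (x \<otimes>\<^bsub>D\<^esub> y) = (q \<circ> s) x \<otimes>\<^bsub>R Quot J Quot I\<^esub> (q \<circ> s) y"
      if xy: "x \<in> carrier D" "y \<in> carrier D" for x y
    proof -
      obtain a b where ab: "a \<in> carrier R" "b \<in> carrier R" "x = \<theta> a" "y = \<theta> b"
        using img[OF xy(1)] img[OF xy(2)] by blast
      then have "x \<otimes>\<^bsub>D\<^esub> y = \<theta> (a \<otimes>\<^bsub>R\<^esub> b)" by (simp add: ring_hom_mult[OF \<theta>])
      then show ?thesis using ab by (simp add: key ring_hom_mult[OF q])
    qed
    show "(q \<circ> s) (x \<oplus>\<^bsub>D\<^esub> y) = (q \<circ> s) x \<oplus>\<^bsub>R Quot J Quot I\<^esub> (q \<circ> s) y"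
      if xy: "x \<in> carrier D" "y \<in> carrier D" for x y
    proof -
      obtain a b where ab: "a \<in> carrier R" "b \<in> carrier R" "x = \<theta> a" "y = \<theta> b"
        using img[OF xy(1)] img[OF xy(2)] by blast
      then have "x \<oplus>\<^bsub>D\<^esub> y = \<theta> (a \<oplus>\<^bsub>R\<^esub> b)" by (simp add: ring_hom_add[OF \<theta>])
      then show ?thesis using ab by (simp add: key ring_hom_add[OF q])
    qed
    show "(q \<circ> s) \<one>\<^bsub>D\<^esub> = \<one>\<^bsub>R Quot J Quot I\<^esub>"
      using key[of "\<one>\<^bsub>R\<^esub>"] by (simp add: ring_hom_one[OF \<theta>] ring_hom_one[OF q])
    show "bij_betw (q \<circ> s) (carrier D) (carrier (R Quot J Quot I))"
      unfolding bij_betw_def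
    proof
      show "inj_on (q \<circ> s) (carrier D)"
        by (rule inj_onI) (metis comp_apply q_eq s)
      have "\<exists>d\<in>carrier D. z = (q \<circ> s) d" if z: "z \<in> carrier (R Quot J Quot I)" for z
      proof -
        obtain t where t: "t \<in> carrier (R Quot J)" "z = I +>\<^bsub>R Quot J\<^esub> t"
          using z unfolding FactRing_def[of "R Quot J"] A_RCOSETS_def' by auto
        obtain x where x: "x \<in> carrier R" "t = J +>\<^bsub>R\<^esub> x"
          using t(1) unfolding FactRing_def[of R] A_RCOSETS_def' by auto
        show ?thesis using x t \<theta>c key by (intro bexI[of _ "\<theta> x"]) (auto simp: q_def)
      qed
      then show "(q \<circ> s) ` carrier D = carrier (R Quot J Quot I)"
        using s ring_hom_closed[OF q] by auto
    qed
  qed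
  then show ?thesis using key by (intro bexI[of _ "q \<circ> s"]) (auto simp: q_def)
qed

lemma (in cring) finprod_zero_factor:
  assumes "finite A" "f \<in> A \<rightarrow> carrier R" "a \<in> A" "f a = \<zero>"
  shows "finprod R f A = \<zero>"
proof -
  have "finprod R f (insert a (A - {a})) = f a \<otimes> finprod R f (A - {a})"
    using assms by (intro finprod_insert) auto
  moreover have "finprod R f (A - {a}) \<in> carrier R" using assms by (intro finprod_closed) auto
  ultimately show ?thesis using assms by (simp add: insert_absorb)
qed


section \<open>The glider ring\<close>

text \<open>The empty set is excluded because in \<open>glider_basis\<close> it marks the short
  elements. The \<open>group_algebra\<close> of this monoid is the semigroup algebra in which both
  the long part and the short part take values.\<close>

definition power_monoid :: "('a, 'm) monoid_scheme \<Rightarrow> 'a set monoid"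
  where "power_monoid G =
    \<lparr>carrier = {A. A \<noteq> {} \<and> A \<subseteq> carrier G}, mult = (<#>\<^bsub>G\<^esub>), one = {\<one>\<^bsub>G\<^esub>}\<rparr>"

lemma power_monoid_simps:
  "A \<in> carrier (power_monoid G) \<longleftrightarrow> A \<noteq> {} \<and> A \<subseteq> carrier G"
  "A \<otimes>\<^bsub>power_monoid G\<^esub> B = A <#>\<^bsub>G\<^esub> B"
  "\<one>\<^bsub>power_monoid G\<^esub> = {\<one>\<^bsub>G\<^esub>}"
  by (simp_all add: power_monoid_def)

lemma sum_chi_combination:
  assumes "finite B" and "\<And>c. c \<in> S \<Longrightarrow> k c \<in> B"
  shows "(\<Sum>r\<in>B. (\<Sum>c\<in>S. w c * chi (k c) r) * F r) = (\<Sum>c\<in>S. w c * F (k c))"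
proof -
  have "(\<Sum>r\<in>B. (\<Sum>c\<in>S. w c * chi (k c) r) * F r) = (\<Sum>c\<in>S. \<Sum>r\<in>B. w c * (chi (k c) r * F r))"
    by (subst sum.swap) (simp add: sum_distrib_right mult.assoc)
  also have "\<dots> = (\<Sum>c\<in>S. w c * F (k c))"
    using assms by (simp add: sum_distrib_left[symmetric] sum_chi)
  finally show ?thesis .
qed

text \<open>With a structure constant for \<open>F\<close>, this evaluates the right-hand side of
  the multiplicativity condition in \<open>structure_algebra_hom\<close> when basis elements are
  sent to sums of basis elements.\<close>

lemma sum_sum_chi_combination:
  assumes "finite B" and "S \<subseteq> B" and "S' \<subseteq> B"
  shows "(\<Sum>i\<in>B. \<Sum>i'\<in>B. (\<Sum>s\<in>S. chi s i) * (\<Sum>s\<in>S'. chi s i') * F i i') =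
    (\<Sum>s\<in>S. \<Sum>s'\<in>S'. F s s')"
proof -
  have "(\<Sum>i\<in>B. \<Sum>i'\<in>B. (\<Sum>s\<in>S. chi s i) * (\<Sum>s\<in>S'. chi s i') * F i i') =
      (\<Sum>i\<in>B. (\<Sum>s\<in>S. 1 * chi s i) * (\<Sum>i'\<in>B. (\<Sum>s\<in>S'. 1 * chi s i') * F i i'))"
    by (simp only: mult.assoc sum_distrib_left[symmetric] mult_1)
  then show ?thesis
    using assms by (subst (asm) (1 2) sum_chi_combination) auto
qed

lemma (in monoid) set_mult_nonempty:
  "A \<noteq> {} \<Longrightarrow> B \<noteq> {} \<Longrightarrow> A <#> B \<noteq> {}"
  by (auto simp: set_mult_def)

lemma (in comm_group) set_mult_comm:
  "A \<subseteq> carrier G \<Longrightarrow> B \<subseteq> carrier G \<Longrightarrow> A <#> B = B <#> A"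
  unfolding set_mult_def using m_comm by blast

lemma (in comm_group) power_monoid_comm_monoid: "comm_monoid (power_monoid G)"
proof (rule comm_monoidI)
  show "\<one>\<^bsub>power_monoid G\<^esub> \<otimes>\<^bsub>power_monoid G\<^esub> A = A" if "A \<in> carrier (power_monoid G)" for A
    using that by (force simp: power_monoid_simps set_mult_def)
  show "A \<otimes>\<^bsub>power_monoid G\<^esub> B = B \<otimes>\<^bsub>power_monoid G\<^esub> A"
    if "A \<in> carrier (power_monoid G)" "B \<in> carrier (power_monoid G)" for A B
    using that by (simp add: power_monoid_simps set_mult_comm)
qed (simp_all add: power_monoid_simps set_mult_nonempty set_mult_assoc set_mult_closed)

text \<open>The characters are kept out of the algebra: \<pi> enters as a homomorphism of
  \<open>G\<close> with values in \<open>H\<close>, which \<open>dual_restriction_hom\<close>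
  supplies.\<close>

locale glider_chain = comm_group G for G (structure) +
  fixes H :: "'a set" and \<pi> :: "'a \<Rightarrow> 'a"
  assumes fin: "finite (carrier G)" and H: "subgroup H G"
    and pi_hom: "\<pi> \<in> hom G G" and pi_H: "\<pi> ` carrier G \<subseteq> H"
begin

abbreviation "basis \<equiv> glider_basis G H \<pi>"
abbreviation "R \<equiv> glider_ring G H \<pi>"
abbreviation "P \<equiv> power_monoid G"

lemmas R_simps = structure_algebra_simps[of basis "glider_mult G \<pi>" "chi ({\<one>}, {\<one>})",
  folded glider_ring_def]

lemma pi_one [simp]: "\<pi> \<one> = \<one>"
  using pi_hom by (simp add: hom_one)

lemma pi_closed [simp]: "x \<in> carrier G \<Longrightarrow> \<pi> x \<in> carrier G"
  using pi_hom by (auto simp: hom_def)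

lemma pi_mult: "x \<in> carrier G \<Longrightarrow> y \<in> carrier G \<Longrightarrow> \<pi> (x \<otimes> y) = \<pi> x \<otimes> \<pi> y"
  using pi_hom by (auto simp: hom_def)

lemma H_carrier: "h \<in> H \<Longrightarrow> h \<in> carrier G"
  using H by (rule subgroup.mem_carrier)

lemma finite_basis: "finite basis"
proof (rule finite_subset)
  show "basis \<subseteq> Pow (carrier G) \<times> Pow (carrier G)"
    using H_carrier by (auto simp: glider_basis_def)
qed (simp add: fin)

lemma finite_P: "finite (carrier P)"
  by (rule finite_subset[of _ "Pow (carrier G)"]) (auto simp: power_monoid_simps fin)

lemma basis_long: "A \<noteq> {} \<Longrightarrow> (A, A') \<in> basis \<longleftrightarrow> A \<subseteq> carrier G \<and> A' = \<pi> ` A"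
  by (auto simp: glider_basis_def)

lemma basis_short: "({}, B) \<in> basis \<longleftrightarrow> B \<noteq> {} \<and> B \<subseteq> H"
  by (auto simp: glider_basis_def)

lemma pi_set_mult:
  "A \<subseteq> carrier G \<Longrightarrow> B \<subseteq> carrier G \<Longrightarrow> \<pi> ` (A <#> B) = \<pi> ` A <#> \<pi> ` B"
  by (force simp: set_mult_def pi_mult)

lemma basis_cases:
  assumes "p \<in> basis"
  obtains (long) A where "p = (A, \<pi> ` A)" "A \<noteq> {}" "A \<subseteq> carrier G"
  | (short) B where "p = ({}, B)" "B \<noteq> {}" "B \<subseteq> H"
  using assms by (auto simp: glider_basis_def)

lemma set_mult_H: "A \<subseteq> H \<Longrightarrow> B \<subseteq> H \<Longrightarrow> A <#> B \<subseteq> H"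
  using subgroup.m_closed[OF H] by (auto simp: set_mult_def)

lemma r_coset_H: "A \<subseteq> H \<Longrightarrow> h \<in> H \<Longrightarrow> A #> h \<subseteq> H"
  using subgroup.m_closed[OF H] by (auto simp: r_coset_def)

lemma pi_image_H: "A \<subseteq> carrier G \<Longrightarrow> \<pi> ` A \<subseteq> H"
  using pi_H by auto

text \<open>The value, on a product of basis elements, of the linear functional given by
  \<open>F\<close>. Together with the next two lemmas this covers every case of
  \<open>glider_mult\<close>, and each homomorphism below is verified along these cases.\<close>

lemma glider_mult_sum_long_long:
  assumes "A \<noteq> {}" "A \<subseteq> carrier G" "B \<noteq> {}" "B \<subseteq> carrier G"
  shows "(\<Sum>r\<in>basis. glider_mult G \<pi> (A, \<pi> ` A) (B, \<pi> ` B) r * F r) =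
    F (A <#> B, \<pi> ` (A <#> B)) + (\<Sum>c\<in>\<pi> ` (A <#> B).
      (of_nat (product_count G (\<pi> ` A) (\<pi> ` B) c) - 1) * F ({}, {c}))"
proof -
  have c: "({}, {c}) \<in> basis" if "c \<in> \<pi> ` (A <#> B)" for c
    using that pi_image_H[OF set_mult_closed[OF assms(2,4)]] by (auto simp: basis_short)
  have "(A <#> B, \<pi> ` (A <#> B)) \<in> basis"
    using assms by (simp add: basis_long set_mult_nonempty set_mult_closed)
  then show ?thesis
    using assms c
    by (simp add: distrib_right sum.distrib sum_chi finite_basis sum_chi_combination)
qed

lemma glider_mult_sum_long_short:
  assumes "A \<noteq> {}" "A \<subseteq> carrier G" "B \<noteq> {}" "B \<subseteq> H"
  shows "(\<Sum>r\<in>basis. glider_mult G \<pi> (A, \<pi> ` A) ({}, B) r * F r) =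
      (\<Sum>h\<in>\<pi> ` A. F ({}, B #> h))"
    and "(\<Sum>r\<in>basis. glider_mult G \<pi> ({}, B) (A, \<pi> ` A) r * F r) =
      (\<Sum>h\<in>\<pi> ` A. F ({}, B #> h))"
proof -
  have c: "({}, B #> h) \<in> basis" if "h \<in> \<pi> ` A" for h
    using that r_coset_H[OF assms(4)] pi_image_H[OF assms(2)] assms(3)
    by (auto simp: basis_short r_coset_def)
  have "(\<Sum>r\<in>basis. (\<Sum>h\<in>\<pi> ` A. chi ({}, B #> h) r) * F r) = (\<Sum>h\<in>\<pi> ` A. F ({}, B #> h))"
    using sum_chi_combination[OF finite_basis, of "\<pi> ` A" "\<lambda>h. ({}, B #> h)" "\<lambda>_. 1" F] c
    by simp
  then show "(\<Sum>r\<in>basis. glider_mult G \<pi> (A, \<pi> ` A) ({}, B) r * F r) =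
      (\<Sum>h\<in>\<pi> ` A. F ({}, B #> h))"
    "(\<Sum>r\<in>basis. glider_mult G \<pi> ({}, B) (A, \<pi> ` A) r * F r) =
      (\<Sum>h\<in>\<pi> ` A. F ({}, B #> h))"
    using assms(1) by simp_all
qed

lemma glider_mult_sum_short_short:
  assumes "A \<noteq> {}" "A \<subseteq> H" "B \<noteq> {}" "B \<subseteq> H"
  shows "(\<Sum>r\<in>basis. glider_mult G \<pi> ({}, A) ({}, B) r * F r) = F ({}, A <#> B)"
proof -
  have "({}, A <#> B) \<in> basis"
    using assms by (simp add: basis_short set_mult_nonempty set_mult_H)
  then show ?thesis by (simp add: sum_chi finite_basis)
qed

section \<open>Long part, short part and coset parts as ring homomorphisms\<close>

text \<open>Written as a sum over the basis to match the form of
  \<open>structure_algebra_hom\<close>; \<open>long_part_eq\<close> later reads it as a restriction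
  of coefficients.\<close>

definition long_part where "long_part x = (\<lambda>A. \<Sum>p\<in>basis. x p * (if fst p = {} then 0 else chi (fst p) A))"

text \<open>Multiplying a short element by a long one gives the sum of its translates by the points
  of \<open>snd p\<close>. This is multiplication by the sum of the corresponding singletons, so
  that sum has to be the image of the long element.\<close>

definition short_support :: "'a set \<times> 'a set \<Rightarrow> 'a set set"
  where "short_support p = (if fst p = {} then {snd p} else (\<lambda>h. {h}) ` snd p)"

definition short_part where "short_part x = (\<lambda>B. \<Sum>p\<in>basis. x p * (\<Sum>s\<in>short_support p. chi s B))"

text \<open>A nonempty set lies in at most one coset of \<open>L\<close>, so a long basis element is
  sent to a single coset or to 0.\<close>

definition coset_part where "coset_part L x =
  (\<lambda>D. \<Sum>p\<in>basis. x p * (if fst p \<noteq> {} \<and> fst p \<subseteq> D \<and> D \<in> rcosets L then 1 else 0))"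

text \<open>The short summands in a product of long elements are killed, and a product with a short
  factor has short summands only. What remains is the multiplication of sets.\<close>

lemma long_part_hom: "long_part \<in> ring_hom R (group_algebra P)"
  unfolding long_part_def[abs_def] glider_ring_def group_algebra_def
proof (rule structure_algebra_hom[OF finite_basis])
  show "(if fst p = {} then 0 else chi (fst p) j) = 0" if "p \<in> basis" "j \<notin> carrier P" for p j
    using that(1) by (cases rule: basis_cases) (use that(2) in \<open>auto simp: chi_def power_monoid_simps\<close>)
  have "({\<one>}, {\<one>}) \<in> basis" by (simp add: basis_long)
  then show "(\<Sum>p\<in>basis. chi ({\<one>}, {\<one>}) p * (if fst p = {} then 0 else chi (fst p) j)) =
      chi \<one>\<^bsub>P\<^esub> j" for j
    by (simp add: sum_chi finite_basis power_monoid_simps)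
  show "(\<Sum>r\<in>basis. glider_mult G \<pi> p q r * (if fst r = {} then 0 else chi (fst r) j)) =
      (\<Sum>i\<in>carrier P. \<Sum>i'\<in>carrier P. (if fst p = {} then 0 else chi (fst p) i) *
        (if fst q = {} then 0 else chi (fst q) i') * chi (i \<otimes>\<^bsub>P\<^esub> i') j)"
    if "p \<in> basis" "q \<in> basis" for p q j
    using that(1)
  proof (cases rule: basis_cases)
    case p: (long A)
    show ?thesis using that(2)
    proof (cases rule: basis_cases)
      case q: (long B)
      have "(\<Sum>i\<in>carrier P. \<Sum>i'\<in>carrier P. chi A i * chi B i' * chi (i \<otimes>\<^bsub>P\<^esub> i') j) =
          chi (A <#> B) j"
        using p q sum_sum_chi_combination[OF finite_P, of "{A}" "{B}" "\<lambda>i i'. chi (i \<otimes>\<^bsub>P\<^esub> i') j"]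
        by (simp add: power_monoid_simps)
      then show ?thesis
        unfolding p(1) q(1) glider_mult_sum_long_long[OF p(2,3) q(2,3)]
          using p q by (simp add: set_mult_nonempty)
    next
      case q: (short B)
      show ?thesis
        unfolding p(1) q(1) glider_mult_sum_long_short(1)[OF p(2,3) q(2,3)]
          using p q by simp
    qed
  next
    case p: (short A)
    show ?thesis using that(2)
    proof (cases rule: basis_cases)
      case q: (long B)
      show ?thesis unfolding p(1) q(1) glider_mult_sum_long_short(2)[OF q(2,3) p(2,3)]
          using p q by simp
    next
      case q: (short B)
      show ?thesis unfolding p(1) q(1) glider_mult_sum_short_short[OF p(2,3) q(2,3)]
          using p q by simp
    qed
  qed
qed

lemma short_support_P: "p \<in> basis \<Longrightarrow> short_support p \<subseteq> carrier P"
  by (erule basis_cases) (auto simp: short_support_def power_monoid_simps H_carrier)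

text \<open>In the product of two sums of singletons, \<open>{c}\<close> occurs as often as
  \<open>c\<close> is a product of points of the two images. On the other side the long summand
  contributes \<open>{c}\<close> once and the short summands contribute the count minus 1; this
  explains the correction term in the multiplication.\<close>

lemma short_part_hom: "short_part \<in> ring_hom R (group_algebra P)"
  unfolding short_part_def[abs_def] glider_ring_def group_algebra_def
proof (rule structure_algebra_hom[OF finite_basis])
  show "(\<Sum>s\<in>short_support p. chi s j) = 0" if "p \<in> basis" "j \<notin> carrier P" for p j
    using short_support_P[OF that(1)] that(2) by (intro sum.neutral) (auto simp: chi_def)
  have "({\<one>}, {\<one>}) \<in> basis" by (simp add: basis_long)
  then show "(\<Sum>p\<in>basis. chi ({\<one>}, {\<one>}) p * (\<Sum>s\<in>short_support p. chi s j)) = chi \<one>\<^bsub>P\<^esub> j" for j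
    by (simp add: sum_chi finite_basis power_monoid_simps short_support_def)
  have sing: "(\<Sum>s\<in>(\<lambda>h. {h}) ` X. F s) = (\<Sum>h\<in>X. F {h})" for X and F :: "'a set \<Rightarrow> rat"
    by (simp add: sum.reindex comp_def)
  show "(\<Sum>r\<in>basis. glider_mult G \<pi> p q r * (\<Sum>s\<in>short_support r. chi s j)) =
      (\<Sum>i\<in>carrier P. \<Sum>i'\<in>carrier P. (\<Sum>s\<in>short_support p. chi s i) *
        (\<Sum>s\<in>short_support q. chi s i') * chi (i \<otimes>\<^bsub>P\<^esub> i') j)"
    if pq: "p \<in> basis" "q \<in> basis" for p q j
  proof -
    have "(\<Sum>i\<in>carrier P. \<Sum>i'\<in>carrier P. (\<Sum>s\<in>short_support p. chi s i) *
        (\<Sum>s\<in>short_support q. chi s i') * chi (i \<otimes>\<^bsub>P\<^esub> i') j) =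
      (\<Sum>s\<in>short_support p. \<Sum>s'\<in>short_support q. chi (s <#> s') j)"
      unfolding power_monoid_simps
      by (rule sum_sum_chi_combination[OF finite_P short_support_P[OF pq(1)] short_support_P[OF pq(2)]])
    also have "\<dots> = (\<Sum>r\<in>basis. glider_mult G \<pi> p q r * (\<Sum>s\<in>short_support r. chi s j))"
      using pq(1)
    proof (cases rule: basis_cases)
      case p: (long A)
      show ?thesis using pq(2)
      proof (cases rule: basis_cases)
        case q: (long B)
        let ?X = "\<pi> ` A" and ?Y = "\<pi> ` B" and ?g = "\<lambda>(h, h'). h \<otimes> h'"
        have XY: "\<pi> ` (A <#> B) = ?g ` (?X \<times> ?Y)"
          unfolding pi_set_mult[OF p(3) q(3)] by (force simp: set_mult_def)
        have "finite (?X \<times> ?Y)"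
          using finite_subset[OF p(3) fin] finite_subset[OF q(3) fin] by simp
        \<comment> \<open>The pairs are grouped by their product \<open>c\<close>; the fibre over
          \<open>c\<close> has \<open>product_count\<close> elements.\<close>
        then have "(\<Sum>z\<in>?X \<times> ?Y. chi {?g z} j) =
            (\<Sum>c\<in>?g ` (?X \<times> ?Y). \<Sum>z\<in>{z \<in> ?X \<times> ?Y. ?g z = c}. chi {?g z} j)"
          by (rule sum.image_gen)
        also have "\<dots> = (\<Sum>c\<in>\<pi> ` (A <#> B). of_nat (product_count G ?X ?Y c) * chi {c} j)"
          unfolding XY
        proof (rule sum.cong)
          fix c
          have "(\<Sum>z\<in>{z \<in> ?X \<times> ?Y. ?g z = c}. chi {?g z} j) =
              (\<Sum>z\<in>{z \<in> ?X \<times> ?Y. ?g z = c}. chi {c} j)"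
            by (rule sum.cong) auto
          moreover have "{z \<in> ?X \<times> ?Y. ?g z = c} = {(h, h'). h \<in> ?X \<and> h' \<in> ?Y \<and> h \<otimes> h' = c}"
            by auto
          ultimately show "(\<Sum>z\<in>{z \<in> ?X \<times> ?Y. ?g z = c}. chi {?g z} j) =
              of_nat (product_count G ?X ?Y c) * chi {c} j"
            by (simp add: product_count_def)
        qed simp
        finally have *: "(\<Sum>h\<in>?X. \<Sum>h'\<in>?Y. chi {h \<otimes> h'} j) =
            (\<Sum>c\<in>\<pi> ` (A <#> B). of_nat (product_count G ?X ?Y c) * chi {c} j)"
          by (simp add: sum.cartesian_product case_prod_beta)
        have "{h} <#> {h'} = {h \<otimes> h'}" for h h' by (simp add: set_mult_def)
        then have "(\<Sum>s\<in>short_support p. \<Sum>s'\<in>short_support q. chi (s <#> s') j) =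
            (\<Sum>h\<in>?X. \<Sum>h'\<in>?Y. chi {h \<otimes> h'} j)"
          using p q by (simp add: short_support_def sing)
        then show ?thesis unfolding *
          unfolding p(1) q(1) glider_mult_sum_long_long[OF p(2,3) q(2,3)]
          using p q by (simp add: short_support_def sing set_mult_nonempty sum.distrib[symmetric] algebra_simps)
      next
        case q: (short B)
        have "{h} <#> B = B #> h" if "h \<in> \<pi> ` A" for h
          using that p q H_carrier by (subst set_mult_comm) (auto simp: r_coset_eq_set_mult)
        then show ?thesis
          unfolding p(1) q(1) glider_mult_sum_long_short(1)[OF p(2,3) q(2,3)]
          using p q by (simp add: short_support_def sing)
      qed
    next
      case p: (short A)
      show ?thesis using pq(2)
      proof (cases rule: basis_cases)
        case q: (long B)
        show ?thesis
          unfolding p(1) q(1) glider_mult_sum_long_short(2)[OF q(2,3) p(2,3)]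
          using p q by (simp add: short_support_def sing r_coset_eq_set_mult)
      next
        case q: (short B)
        show ?thesis
          unfolding p(1) q(1) glider_mult_sum_short_short[OF p(2,3) q(2,3)]
          using p q by (simp add: short_support_def)
      qed
    qed
    finally show ?thesis by simp
  qed
qed

text \<open>A coset of \<open>L\<close> containing \<open>A\<close> contains the point
  \<open>a\<close>, hence is \<open>L #> a\<close>. In this form the image of \<open>A\<close> is
  visibly a multiple of one basis element.\<close>

lemma coset_indicator:
  assumes L: "subgroup L G" and A: "A \<subseteq> carrier G" "a \<in> A"
  shows "(if A \<noteq> {} \<and> A \<subseteq> D \<and> D \<in> rcosets L then 1 else 0) =
    (if A \<subseteq> L #> a then chi (L #> a) D else 0)"
proof -
  have a: "a \<in> carrier G" using A by auto
  have "D = L #> a" if D: "A \<subseteq> D" "D \<in> rcosets L"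
  proof -
    obtain x where x: "x \<in> carrier G" "D = L #> x" using D(2) by (auto simp: RCOSETS_def)
    then have "a \<in> L #> x" using D(1) A(2) by auto
    from repr_independence[OF this x(1) L] x(2) show ?thesis by simp
  qed
  moreover have "L #> a \<in> rcosets L"
    using a L by (simp add: rcosetsI subgroup.subset)
  ultimately have "A \<noteq> {} \<and> A \<subseteq> D \<and> D \<in> rcosets L \<longleftrightarrow> A \<subseteq> L #> a \<and> D = L #> a"
    using A(2) by blast
  then show ?thesis by (simp add: chi_def)
qed

text \<open>The heart of the multiplicativity of coset parts. Multiplying \<open>A\<close> by the
  fixed point \<open>b\<close>, or \<open>B\<close> by \<open>a\<close>, stays inside the product
  set, and cancellation gives the two inclusions; conversely, cosets multiply to cosets.\<close>

lemma set_mult_subset_coset_iff: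
  assumes L: "subgroup L G" and A: "A \<subseteq> carrier G" "a \<in> A" and B: "B \<subseteq> carrier G" "b \<in> B"
  shows "A <#> B \<subseteq> L #> (a \<otimes> b) \<longleftrightarrow> A \<subseteq> L #> a \<and> B \<subseteq> L #> b"
proof
  have ab: "a \<in> carrier G" "b \<in> carrier G" using A B by auto
  {
    assume *: "A <#> B \<subseteq> L #> (a \<otimes> b)"
    have "x \<in> L #> a" if "x \<in> A" for x
    proof -
      have x: "x \<in> carrier G" using that A by auto
      have "x \<otimes> b \<in> A <#> B" using that B by (auto simp: set_mult_def)
      then obtain l where l: "l \<in> L" "x \<otimes> b = l \<otimes> (a \<otimes> b)" using * by (auto simp: r_coset_def)
      then have "x \<otimes> b = (l \<otimes> a) \<otimes> b" using ab subgroup.mem_carrier[OF L] by (simp add: m_assoc)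
      then have "x = l \<otimes> a" using x ab l(1) subgroup.mem_carrier[OF L] by simp
      then show ?thesis using l(1) by (auto simp: r_coset_def)
    qed
    moreover have "x \<in> L #> b" if "x \<in> B" for x
    proof -
      have x: "x \<in> carrier G" using that B by auto
      have "a \<otimes> x \<in> A <#> B" using that A by (auto simp: set_mult_def)
      then obtain l where l: "l \<in> L" "a \<otimes> x = l \<otimes> (a \<otimes> b)" using * by (auto simp: r_coset_def)
      then have "a \<otimes> x = a \<otimes> (l \<otimes> b)" using ab subgroup.mem_carrier[OF L] by (simp add: m_lcomm)
      then have "x = l \<otimes> b" using x ab l(1) subgroup.mem_carrier[OF L] by simp
      then show ?thesis using l(1) by (auto simp: r_coset_def)
    qed
    ultimately show "A \<subseteq> L #> a \<and> B \<subseteq> L #> b" by auto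
  }
  assume "A \<subseteq> L #> a \<and> B \<subseteq> L #> b"
  then have "A <#> B \<subseteq> (L #> a) <#> (L #> b)" by (auto simp: set_mult_def)
  also have "\<dots> = L #> (a \<otimes> b)"
    using normal.rcos_sum[OF subgroup_imp_normal[OF L]] ab by simp
  finally show "A <#> B \<subseteq> L #> (a \<otimes> b)" .
qed

lemma finite_rcosets: "subgroup L G \<Longrightarrow> finite (rcosets L)"
  using fin by (simp add: RCOSETS_def)

text \<open>Short elements go to 0. For long elements both sides are multiples of the coset of
  \<open>a \<otimes> b\<close>, and the indicator of the product set is the product of the
  indicators by \<open>set_mult_subset_coset_iff\<close>.\<close>

lemma coset_part_hom:
  assumes L: "subgroup L G"
  shows "coset_part L \<in> ring_hom R (group_algebra (G Mod L))"
  unfolding coset_part_def[abs_def] glider_ring_def group_algebra_def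
proof (rule structure_algebra_hom[OF finite_basis])
  let ?m = "\<lambda>p D. if fst p \<noteq> {} \<and> fst p \<subseteq> D \<and> D \<in> rcosets L then 1 else 0 :: rat"
  show "?m p j = 0" if "j \<notin> carrier (G Mod L)" for p :: "'a set \<times> 'a set" and j
    using that by (simp add: FactGroup_def)
  have "({\<one>}, {\<one>}) \<in> basis" by (simp add: basis_long)
  then show "(\<Sum>p\<in>basis. chi ({\<one>}, {\<one>}) p * ?m p j) = chi \<one>\<^bsub>G Mod L\<^esub> j" for j
    using coset_indicator[OF L, of "{\<one>}" \<one> j] subgroup.subset[OF L] subgroup.one_closed[OF L]
    by (simp add: sum_chi finite_basis)
  show "(\<Sum>r\<in>basis. glider_mult G \<pi> p q r * ?m r j) =
      (\<Sum>i\<in>carrier (G Mod L). \<Sum>i'\<in>carrier (G Mod L). ?m p i * ?m q i' *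
        chi (i \<otimes>\<^bsub>G Mod L\<^esub> i') j)"
    if "p \<in> basis" "q \<in> basis" for p q j
    using that(1)
  proof (cases rule: basis_cases)
    case p: (long A)
    show ?thesis using that(2)
    proof (cases rule: basis_cases)
      case q: (long B)
      obtain a b where ab: "a \<in> A" "b \<in> B" using p q by auto
      then have ab': "a \<in> carrier G" "b \<in> carrier G" "a \<otimes> b \<in> A <#> B"
        using p q by (auto simp: set_mult_def)
      let ?\<alpha> = "if A \<subseteq> L #> a then 1 else 0 :: rat" and ?\<beta> = "if B \<subseteq> L #> b then 1 else 0 :: rat"
      have *: "(\<Sum>i\<in>carrier (G Mod L). \<Sum>i'\<in>carrier (G Mod L). chi (L #> a) i *
          chi (L #> b) i' * chi (i \<otimes>\<^bsub>G Mod L\<^esub> i') j) = chi (L #> (a \<otimes> b)) j"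
        using sum_sum_chi_combination[OF finite_rcosets[OF L], of "{L #> a}" "{L #> b}"
            "\<lambda>i i'. chi (i \<otimes>\<^bsub>G Mod L\<^esub> i') j"] ab'
          normal.rcos_sum[OF subgroup_imp_normal[OF L]] L
        by (simp add: FactGroup_def rcosetsI subgroup.subset)
      have m: "?m p i = ?\<alpha> * chi (L #> a) i" "?m q i = ?\<beta> * chi (L #> b) i" for i
        using coset_indicator[OF L, of A a i] coset_indicator[OF L, of B b i] p q ab by auto
      have "(\<Sum>i\<in>carrier (G Mod L). \<Sum>i'\<in>carrier (G Mod L). ?m p i * ?m q i' *
          chi (i \<otimes>\<^bsub>G Mod L\<^esub> i') j) = ?\<alpha> * ?\<beta> * chi (L #> (a \<otimes> b)) j"
        unfolding m *[symmetric] sum_distrib_left by (simp add: mult_ac)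
      also have "\<dots> = ?m (A <#> B, \<pi> ` (A <#> B)) j"
        using coset_indicator[OF L set_mult_closed ab'(3), of j]
          set_mult_subset_coset_iff[OF L _ ab(1) _ ab(2)] p q
        by (simp split: if_splits)
      finally show ?thesis
        unfolding p(1) q(1) glider_mult_sum_long_long[OF p(2,3) q(2,3)]
          using p q by simp
    next
      case q: (short B)
      show ?thesis
        unfolding p(1) q(1) glider_mult_sum_long_short(1)[OF p(2,3) q(2,3)]
          using p q by simp
    qed
  next
    case p: (short A)
    show ?thesis using that(2)
    proof (cases rule: basis_cases)
      case q: (long B)
      show ?thesis unfolding p(1) q(1) glider_mult_sum_long_short(2)[OF q(2,3) p(2,3)]
          using p q by simp
    next
      case q: (short B)
      show ?thesis unfolding p(1) q(1) glider_mult_sum_short_short[OF p(2,3) q(2,3)]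
          using p q by simp
    qed
  qed
qed


section \<open>The corner ring\<close>

abbreviation "C \<equiv> glider_corner G H \<pi>"
abbreviation "e \<equiv> glider_idem G H \<pi>"

lemma long_part_eq: "long_part x A = (if A \<in> carrier P then x (A, \<pi> ` A) else 0)"
proof -
  have "long_part x A = (\<Sum>p\<in>basis. if p = (A, \<pi> ` A) \<and> A \<noteq> {} then x (A, \<pi> ` A) else 0)"
    unfolding long_part_def
    by (rule sum.cong) (auto simp: chi_def elim: basis_cases)
  also have "\<dots> = (if A \<in> carrier P then x (A, \<pi> ` A) else 0)"
    by (cases "A = {}") (auto simp: finite_basis basis_long power_monoid_simps)
  finally show ?thesis .
qed

text \<open>Shows the coset part as a sum over the subsets of \<open>D\<close>, the form in which it
  can be inverted when the kernel is determined.\<close>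

lemma coset_part_eq:
  assumes "D \<in> rcosets L"
  shows "coset_part L x D = (\<Sum>A | A \<in> carrier P \<and> A \<subseteq> D. long_part x A)"
proof -
  have "coset_part L x D = (\<Sum>p\<in>basis. if fst p \<noteq> {} \<and> fst p \<subseteq> D then x p else 0)"
    unfolding coset_part_def using assms by (intro sum.cong) auto
  also have "\<dots> = (\<Sum>p | p \<in> basis \<and> fst p \<noteq> {} \<and> fst p \<subseteq> D. x p)"
    by (simp add: sum.If_cases finite_basis Int_def)
  also have "\<dots> = (\<Sum>A | A \<in> carrier P \<and> A \<subseteq> D. x (A, \<pi> ` A))"
    by (rule sum.reindex_bij_witness[of _ "\<lambda>A. (A, \<pi> ` A)" fst])
      (auto simp: power_monoid_simps basis_long elim!: basis_cases)
  finally show ?thesis by (simp add: long_part_eq)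
qed

lemma part_combination:
  "long_part (\<lambda>r. \<Sum>a\<in>S. w a * v a r) = (\<lambda>j. \<Sum>a\<in>S. w a * long_part (v a) j)"
  "short_part (\<lambda>r. \<Sum>a\<in>S. w a * v a r) = (\<lambda>j. \<Sum>a\<in>S. w a * short_part (v a) j)"
  "coset_part L (\<lambda>r. \<Sum>a\<in>S. w a * v a r) = (\<lambda>j. \<Sum>a\<in>S. w a * coset_part L (v a) j)"
proof -
  have *: "(\<Sum>p\<in>basis. (\<Sum>a\<in>S. w a * v a p) * m p) = (\<Sum>a\<in>S. w a * (\<Sum>p\<in>basis. v a p * m p))" for m
    by (simp only: sum_distrib_left sum_distrib_right mult.assoc) (rule sum.swap)
  show "long_part (\<lambda>r. \<Sum>a\<in>S. w a * v a r) = (\<lambda>j. \<Sum>a\<in>S. w a * long_part (v a) j)"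
    "short_part (\<lambda>r. \<Sum>a\<in>S. w a * v a r) = (\<lambda>j. \<Sum>a\<in>S. w a * short_part (v a) j)"
    "coset_part L (\<lambda>r. \<Sum>a\<in>S. w a * v a r) = (\<lambda>j. \<Sum>a\<in>S. w a * coset_part L (v a) j)"
    by (simp_all only: long_part_def short_part_def coset_part_def *)
qed

lemma part_diff:
  "long_part (\<lambda>r. x r - y r) = (\<lambda>j. long_part x j - long_part y j)"
  "short_part (\<lambda>r. x r - y r) = (\<lambda>j. short_part x j - short_part y j)"
  "coset_part L (\<lambda>r. x r - y r) = (\<lambda>j. coset_part L x j - coset_part L y j)"
  by (simp_all only: long_part_def short_part_def coset_part_def left_diff_distrib sum_subtractf)

lemma short_part_scale: "short_part (\<lambda>r. k * x r) = (\<lambda>j. k * short_part x j)"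
  by (simp only: short_part_def sum_distrib_left mult.assoc)

lemma part_chi:
  assumes "p \<in> basis"
  shows "long_part (chi p) = (\<lambda>A. if fst p = {} then 0 else chi (fst p) A)"
    and "short_part (chi p) = (\<lambda>B. \<Sum>s\<in>short_support p. chi s B)"
    and "coset_part L (chi p) =
      (\<lambda>D. if fst p \<noteq> {} \<and> fst p \<subseteq> D \<and> D \<in> rcosets L then 1 else 0)"
  using assms by (simp_all only: long_part_def short_part_def coset_part_def sum_chi finite_basis)

lemma chi_carrier: "p \<in> basis \<Longrightarrow> chi p \<in> carrier R"
  by (auto simp: R_simps chi_def)

lemma one_basis: "({\<one>}, {\<one>}) \<in> basis" "({}, {\<one>}) \<in> basis"
  using subgroup.one_closed[OF H] by (auto simp: basis_long basis_short)

lemma R_minus: "x \<in> carrier R \<Longrightarrow> y \<in> carrier R \<Longrightarrow> x \<ominus>\<^bsub>R\<^esub> y = (\<lambda>r. x r - y r)"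
  unfolding glider_ring_def by (rule structure_algebra_minus)

lemma idem_eq: "e = (\<lambda>r. chi ({\<one>}, {\<one>}) r - chi ({}, {\<one>}) r)"
  unfolding glider_idem_def using chi_carrier one_basis by (simp add: R_minus R_simps(3))

lemma idem_carrier: "e \<in> carrier R"
  using chi_carrier one_basis by (simp add: idem_eq R_simps(1))

lemma long_part_idem: "long_part e = chi {\<one>}"
  by (auto simp: idem_eq part_diff part_chi one_basis)

lemma short_part_idem: "short_part e = (\<lambda>B. 0)"
  by (auto simp: idem_eq part_diff part_chi one_basis short_support_def)

lemma coset_part_idem:
  assumes "subgroup L G"
  shows "coset_part L e = \<one>\<^bsub>group_algebra (G Mod L)\<^esub>"
proof -
  have "coset_part L e = coset_part L \<one>\<^bsub>R\<^esub>"
    by (simp add: idem_eq part_diff part_chi one_basis R_simps(3))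
  then show ?thesis using ring_hom_one[OF coset_part_hom[OF assms]] by simp
qed

text \<open>The long part determines the coefficients of the long basis elements. Once these agree,
  the difference has short terms only, and its short part displays their coefficients
  unchanged.\<close>

lemma parts_inj:
  assumes xy: "x \<in> carrier R" "y \<in> carrier R"
    and l: "long_part x = long_part y" and s: "short_part x = short_part y"
  shows "x = y"
proof
  fix p
  have long: "x (A, \<pi> ` A) = y (A, \<pi> ` A)" if "A \<noteq> {}" "A \<subseteq> carrier G" for A
    using fun_cong[OF l, of A] that by (simp add: long_part_eq power_monoid_simps)
  show "x p = y p"
  proof (cases "p \<in> basis")
    case True
    then show ?thesis
    proof (cases rule: basis_cases)
      case (short B)
      \<comment> \<open>The singletons coming from long elements carry coefficient 0 in the
        difference, so \<open>({}, B)\<close> alone contributes at \<open>B\<close>.\<close>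
      have "0 = short_part (\<lambda>r. x r - y r) B" by (simp add: part_diff s)
      also have "\<dots> = (\<Sum>q\<in>basis. if q = p then x q - y q else 0)"
        unfolding short_part_def
      proof (rule sum.cong)
        fix q assume "q \<in> basis"
        then show "(x q - y q) * (\<Sum>s\<in>short_support q. chi s B) = (if q = p then x q - y q else 0)"
          using short(1) by (cases rule: basis_cases) (auto simp: long short_support_def chi_def)
      qed simp
      finally show ?thesis using True by (simp add: finite_basis)
    qed (use long in auto)
  qed (use xy in \<open>cases p, simp add: R_simps(1)\<close>)
qed

lemma P_cring: "cring (group_algebra P)"
  by (rule group_algebra_cring[OF power_monoid_comm_monoid finite_P])

lemma R_mult_closed: "x \<otimes>\<^bsub>R\<^esub> y \<in> carrier R"
proof -
  have "glider_mult G \<pi> p q r = 0" if p: "p \<in> basis" and q: "q \<in> basis" and r: "r \<notin> basis" for p q r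
    using p
  proof (cases rule: basis_cases)
    case p: (long A)
    show ?thesis using q
    proof (cases rule: basis_cases)
      case q: (long B)
      have "(A <#> B, \<pi> ` (A <#> B)) \<in> basis"
        using p q by (simp add: basis_long set_mult_nonempty set_mult_closed)
      moreover have "({}, {c}) \<in> basis" if "c \<in> \<pi> ` (A <#> B)" for c
        using that pi_image_H[OF set_mult_closed[OF p(3) q(3)]] by (auto simp: basis_short)
      ultimately show ?thesis
        using p q r by (auto simp: chi_def intro!: sum.neutral)
    next
      case q: (short B)
      have "({}, B #> h) \<in> basis" if "h \<in> \<pi> ` A" for h
        using that r_coset_H[OF q(3)] pi_image_H[OF p(3)] q(2) by (auto simp: basis_short r_coset_def)
      then show ?thesis using p q r by (auto simp: chi_def intro!: sum.neutral split: if_splits)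
    qed
  next
    case p: (short A)
    show ?thesis using q
    proof (cases rule: basis_cases)
      case q: (long B)
      have "({}, A #> h) \<in> basis" if "h \<in> \<pi> ` B" for h
        using that r_coset_H[OF p(3)] pi_image_H[OF q(3)] p(2) by (auto simp: basis_short r_coset_def)
      then show ?thesis using p q r by (auto simp: chi_def intro!: sum.neutral split: if_splits)
    next
      case q: (short B)
      have "({}, A <#> B) \<in> basis"
        using p q by (simp add: basis_short set_mult_nonempty set_mult_H)
      then show ?thesis using p q r by (auto simp: chi_def)
    qed
  qed
  then show "x \<otimes>\<^bsub>R\<^esub> y \<in> carrier R" by (simp add: R_simps)
qed

lemma group_algebra_simps:
  "\<zero>\<^bsub>group_algebra K\<^esub> = (\<lambda>r. 0)" "\<one>\<^bsub>group_algebra K\<^esub> = chi \<one>\<^bsub>K\<^esub>"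
  "x \<oplus>\<^bsub>group_algebra K\<^esub> y = (\<lambda>r. x r + y r)"
  by (simp_all add: group_algebra_def structure_algebra_simps)

text \<open>The long part of \<open>e\<close> is 1 and its short part is 0, so multiplication by
  \<open>e\<close> keeps the one and removes the other.\<close>

lemma mult_idem:
  assumes x: "x \<in> carrier R"
  shows "long_part (x \<otimes>\<^bsub>R\<^esub> e) = long_part x" "short_part (x \<otimes>\<^bsub>R\<^esub> e) = (\<lambda>B. 0)"
proof -
  interpret P: cring "group_algebra P" by (rule P_cring)
  have e: "long_part e = \<one>\<^bsub>group_algebra P\<^esub>" "short_part e = \<zero>\<^bsub>group_algebra P\<^esub>"
    by (simp_all add: long_part_idem short_part_idem group_algebra_simps power_monoid_simps)
  show "long_part (x \<otimes>\<^bsub>R\<^esub> e) = long_part x"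
    using x ring_hom_mult[OF long_part_hom x idem_carrier] ring_hom_closed[OF long_part_hom x]
    by (simp add: e)
  show "short_part (x \<otimes>\<^bsub>R\<^esub> e) = (\<lambda>B. 0)"
    using x ring_hom_mult[OF short_part_hom x idem_carrier] ring_hom_closed[OF short_part_hom x]
    by (simp add: e) (simp add: group_algebra_simps)
qed

text \<open>An element with zero short part has the same two parts as its product with
  \<open>e\<close>, hence equals it by \<open>parts_inj\<close>.\<close>

lemma C_carrier: "carrier C = {x \<in> carrier R. short_part x = (\<lambda>B. 0)}"
proof -
  have "x = x \<otimes>\<^bsub>R\<^esub> e" if "x \<in> carrier R" "short_part x = (\<lambda>B. 0)" for x
    using that by (intro parts_inj) (simp_all add: mult_idem R_mult_closed idem_carrier)
  then show ?thesis
    by (auto simp: glider_corner_def corner_ring_def mult_idem R_mult_closed idem_carrier)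
qed

lemma C_simps:
  "x \<otimes>\<^bsub>C\<^esub> y = x \<otimes>\<^bsub>R\<^esub> y" "x \<oplus>\<^bsub>C\<^esub> y = (\<lambda>r. x r + y r)"
  "\<one>\<^bsub>C\<^esub> = e" "\<zero>\<^bsub>C\<^esub> = (\<lambda>r. 0)"
  by (simp_all add: glider_corner_def corner_ring_def R_simps)

lemma C_inj: "x \<in> carrier C \<Longrightarrow> y \<in> carrier C \<Longrightarrow> long_part x = long_part y \<Longrightarrow> x = y"
  by (rule parts_inj) (simp_all add: C_carrier)

text \<open>The corner inherits addition and multiplication but has the unit \<open>e\<close>, which
  accounts for the condition on the value at \<open>e\<close>.\<close>

lemma C_hom:
  assumes f: "f \<in> ring_hom R S" and e: "f e = \<one>\<^bsub>S\<^esub>"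
  shows "f \<in> ring_hom C S"
  using ring_hom_closed[OF f] ring_hom_mult[OF f] ring_hom_add[OF f] e
  by (intro ring_hom_memI) (auto simp: C_carrier C_simps R_simps)

text \<open>The long part is injective on the corner, so the ring laws come from the semigroup
  algebra of the nonempty subsets.\<close>

lemma C_cring: "cring C"
proof (rule cring_if_inj_hom[OF P_cring])
  interpret P: cring "group_algebra P" by (rule P_cring)
  have add: "short_part (\<lambda>r. x r + y r) = (\<lambda>j. short_part x j + short_part y j)" for x y
    by (simp only: short_part_def distrib_right sum.distrib)
  show "x \<otimes>\<^bsub>C\<^esub> y \<in> carrier C" if "x \<in> carrier C" "y \<in> carrier C" for x y
  proof -
    have "short_part (x \<otimes>\<^bsub>R\<^esub> y) = \<zero>\<^bsub>group_algebra P\<^esub> \<otimes>\<^bsub>group_algebra P\<^esub> \<zero>\<^bsub>group_algebra P\<^esub>"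
      using that ring_hom_mult[OF short_part_hom, of x y] by (simp add: C_carrier group_algebra_simps)
    then have "short_part (x \<otimes>\<^bsub>R\<^esub> y) = \<zero>\<^bsub>group_algebra P\<^esub>" by simp
    then show ?thesis using that
      by (simp add: C_carrier C_simps R_mult_closed group_algebra_simps)
  qed
  show "x \<oplus>\<^bsub>C\<^esub> y \<in> carrier C" if "x \<in> carrier C" "y \<in> carrier C" for x y
    using that by (simp add: C_carrier C_simps R_simps add)
  show "\<one>\<^bsub>C\<^esub> \<in> carrier C" by (simp add: C_carrier C_simps idem_carrier short_part_idem)
  show zero: "\<zero>\<^bsub>C\<^esub> \<in> carrier C" by (simp add: C_carrier C_simps R_simps short_part_def)
  show "\<exists>y\<in>carrier C. y \<oplus>\<^bsub>C\<^esub> x = \<zero>\<^bsub>C\<^esub>" if "x \<in> carrier C" for x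
    using that short_part_scale[of "-1" x]
    by (intro bexI[of _ "\<lambda>r. - x r"]) (simp_all add: C_carrier C_simps R_simps)
  show "long_part \<in> ring_hom C (group_algebra P)"
    by (rule C_hom[OF long_part_hom])
      (simp add: long_part_idem group_algebra_simps power_monoid_simps)
  show "long_part \<zero>\<^bsub>C\<^esub> = \<zero>\<^bsub>group_algebra P\<^esub>"
    by (simp add: C_simps group_algebra_simps long_part_def)
  show "inj_on long_part (carrier C)" by (rule inj_onI) (rule C_inj)
qed

lemma coset_part_hom_C:
  "subgroup L G \<Longrightarrow> coset_part L \<in> ring_hom C (group_algebra (G Mod L))"
  by (rule C_hom[OF coset_part_hom]) (simp_all add: coset_part_idem)

lemma C_minus: "x \<in> carrier C \<Longrightarrow> y \<in> carrier C \<Longrightarrow> x \<ominus>\<^bsub>C\<^esub> y = (\<lambda>r. x r - y r)"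
proof -
  assume x: "x \<in> carrier C" and y: "y \<in> carrier C"
  interpret C: cring C by (rule C_cring)
  have "(\<lambda>r. - y r) \<oplus>\<^bsub>C\<^esub> y = \<zero>\<^bsub>C\<^esub>" by (simp add: C_simps)
  moreover have "(\<lambda>r. - y r) \<in> carrier C"
    using y short_part_scale[of "-1" y] by (simp add: C_carrier R_simps)
  ultimately have "\<ominus>\<^bsub>C\<^esub> y = (\<lambda>r. - y r)" using y by (metis C.minus_equality)
  then show "x \<ominus>\<^bsub>C\<^esub> y = (\<lambda>r. x r - y r)" by (simp add: a_minus_def C_simps)
qed

text \<open>A scalar multiple is the product with the element \<open>k e\<close> of the corner, so
  ideals are rational subspaces.\<close>

lemma ideal_scale:
  assumes I: "ideal I C" and x: "x \<in> I"
  shows "(\<lambda>r. k * x r) \<in> I"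
proof -
  interpret C: cring C by (rule C_cring)
  interpret I: ideal I C by fact
  have xC: "x \<in> carrier C" using x by (rule I.Icarr)
  have "(\<lambda>r. k * e r) \<in> carrier C"
    using C.one_closed by (simp add: C_simps C_carrier short_part_scale R_simps)
  from I.I_l_closed[OF x this] have "(\<lambda>r. k * e r) \<otimes>\<^bsub>C\<^esub> x \<in> I" .
  moreover have "(\<lambda>r. k * e r) \<otimes>\<^bsub>C\<^esub> x = (\<lambda>r. k * (\<one>\<^bsub>C\<^esub> \<otimes>\<^bsub>C\<^esub> x) r)"
    by (simp add: C_simps R_simps sum_distrib_left mult.assoc)
  ultimately show ?thesis using xC by simp
qed

lemma ideal_combination:
  assumes I: "ideal I C" and v: "\<And>a. a \<in> S \<Longrightarrow> v a \<in> I"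
  shows "(\<lambda>r. \<Sum>a\<in>S. w a * v a r) \<in> I"
proof -
  interpret C: cring C by (rule C_cring)
  interpret I: ideal I C by fact
  show ?thesis
    using v
  proof (induction S rule: infinite_finite_induct)
    case (insert a S)
    have "(\<lambda>r. w a * v a r) \<oplus>\<^bsub>C\<^esub> (\<lambda>r. \<Sum>a\<in>S. w a * v a r) \<in> I"
      using insert by (intro I.a_closed ideal_scale[OF I]) auto
    then show ?case using insert by (simp add: C_simps)
  qed (use I.zero_closed in \<open>simp_all add: C_simps\<close>)
qed

text \<open>The whole ring is an ideal, so this is a case of
  \<open>ideal_combination\<close>.\<close>

lemma C_combination:
  "(\<And>a. a \<in> S \<Longrightarrow> v a \<in> carrier C) \<Longrightarrow> (\<lambda>r. \<Sum>a\<in>S. w a * v a r) \<in> carrier C"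
  by (rule ideal_combination) (simp add: ring.oneideal cring.axioms(1) C_cring)

text \<open>The image of a long basis element in the corner, before contraction. Under the long part
  it corresponds to the basis vector \<open>A\<close> of the semigroup algebra.\<close>

definition gen where "gen A = chi (A, \<pi> ` A) \<otimes>\<^bsub>R\<^esub> e"

lemma gen_carrier: "A \<in> carrier P \<Longrightarrow> gen A \<in> carrier C"
  unfolding gen_def by (simp add: C_carrier R_mult_closed mult_idem chi_carrier basis_long power_monoid_simps)

lemma long_part_gen: "A \<in> carrier P \<Longrightarrow> long_part (gen A) = chi A"
  by (simp add: gen_def mult_idem chi_carrier basis_long power_monoid_simps part_chi)

lemma coset_part_gen:
  assumes A: "A \<in> carrier P" and L: "subgroup L G"
  shows "coset_part L (gen A) = (\<lambda>D. if A \<subseteq> D \<and> D \<in> rcosets L then 1 else 0)"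
proof
  fix D
  show "coset_part L (gen A) D = (if A \<subseteq> D \<and> D \<in> rcosets L then 1 else 0)"
  proof (cases "D \<in> rcosets L")
    case True
    have "finite {A. A \<in> carrier P \<and> A \<subseteq> D}" using finite_P by simp
    then show ?thesis
      using A True by (simp add: coset_part_eq long_part_gen)
        (simp add: chi_def)
  qed (simp add: coset_part_def)
qed

end

section \<open>The idempotent power of a subset\<close>

lemma set_power_eq: "set_power G A k = A [^]\<^bsub>power_monoid G\<^esub> k"
  by (induction k) (simp_all add: power_monoid_def nat_pow_def)

text \<open>Translation of \<open>N\<close> by one of its elements is injective, hence onto since
  \<open>N\<close> is finite. That translation by \<open>x\<close> reaches \<open>x\<close> puts the
  unit into \<open>N\<close>; that translation by \<open>y\<close> reaches the unit gives the
  inverse of \<open>y\<close>.\<close>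

lemma (in group) finite_mult_closed_subgroup:
  assumes "finite N" "N \<noteq> {}" "N \<subseteq> carrier G" "N <#> N \<subseteq> N"
  shows "subgroup N G"
proof -
  have cl: "x \<otimes> y \<in> N" if "x \<in> N" "y \<in> N" for x y
    using assms(4) that by (auto simp: set_mult_def)
  have surj: "(\<otimes>) x ` N = N" if x: "x \<in> N" for x
  proof (rule endo_inj_surj)
    show "inj_on ((\<otimes>) x) N" using assms(3) x by (intro inj_onI) (simp add: subset_iff)
  qed (use cl x assms(1) in auto)
  obtain x where x: "x \<in> N" using assms(2) by auto
  then have "x \<in> (\<otimes>) x ` N" by (simp only: surj)
  then obtain z where z: "z \<in> N" "x = x \<otimes> z" by blast
  have "x \<in> carrier G" "z \<in> carrier G" using x z(1) assms(3) by auto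
  then have "z = \<one>" using z(2) by simp
  with z(1) have one: "\<one> \<in> N" by simp
  show ?thesis
  proof (rule subgroupI)
    fix y assume y: "y \<in> N"
    then have "\<one> \<in> (\<otimes>) y ` N" using one by (simp only: surj)
    then obtain z where z: "z \<in> N" "\<one> = y \<otimes> z" by blast
    have yz: "y \<in> carrier G" "z \<in> carrier G" using y z(1) assms(3) by auto
    have "inv y = inv y \<otimes> (y \<otimes> z)" using yz by (simp flip: z(2))
    also have "\<dots> = z" using yz by (simp flip: m_assoc)
    finally show "inv y \<in> N" using z(1) by simp
  qed (use cl assms in auto)
qed

text \<open>Powers in a finite monoid are eventually periodic, and an exponent that is a multiple of
  the period beyond the preperiod gives an idempotent. Two idempotents \<open>E = A^k\<close> and
  \<open>F = A^m\<close> satisfy E = E^m = F^k = F, so the description in the definition is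
  proper.\<close>

lemma (in comm_group) idempotent_power:
  assumes fin: "finite (carrier G)" and A: "A \<noteq> {}" "A \<subseteq> carrier G"
  shows "\<exists>k\<ge>1::nat. idempotent_power G A = A [^]\<^bsub>power_monoid G\<^esub> k"
    and "idempotent_power G A <#> idempotent_power G A = idempotent_power G A"
proof -
  let ?P = "power_monoid G"
  interpret P: comm_monoid ?P by (rule power_monoid_comm_monoid)
  have AP: "A \<in> carrier ?P" using A by (simp add: power_monoid_simps)
  let ?Q = "\<lambda>E. (\<exists>k\<ge>1. E = set_power G A k) \<and> E <#> E = E"
  \<comment> \<open>Positive exponents are required, as the zeroth power is the unit and not
    \<open>E\<close>.\<close>
  have iter: "E [^]\<^bsub>?P\<^esub> Suc n = E" if "E \<in> carrier ?P" "E <#> E = E" for E and n :: nat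
  proof (induction n)
    case (Suc n)
    then show ?case using that(2) P.nat_pow_Suc[of E "Suc n"] by (simp add: power_monoid_simps(2) del: P.nat_pow_Suc)
  qed (use that(1) in simp)
  have unique: "E = F" if E: "?Q E" and F: "?Q F" for E F
  proof -
    obtain k m :: nat where km: "k \<ge> 1" "m \<ge> 1" "E = A [^]\<^bsub>?P\<^esub> k" "F = A [^]\<^bsub>?P\<^esub> m"
      using E F unfolding set_power_eq by blast
    then have EF: "E \<in> carrier ?P" "F \<in> carrier ?P" using AP by auto
    have "E = E [^]\<^bsub>?P\<^esub> m" using iter[OF EF(1), of "m - 1"] E km(2) by simp
    also have "\<dots> = F [^]\<^bsub>?P\<^esub> k" using km AP by (simp add: P.nat_pow_pow mult.commute)
    also have "\<dots> = F" using iter[OF EF(2), of "k - 1"] F km(1) by simp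
    finally show ?thesis .
  qed
  \<comment> \<open>Pigeonhole: infinitely many exponents, finitely many subsets. The shift by one
    makes the exponent \<open>i\<close> where the repetition starts positive.\<close>
  have "\<not> inj_on (\<lambda>k. A [^]\<^bsub>?P\<^esub> (Suc k)) UNIV"
  proof
    assume "inj_on (\<lambda>k. A [^]\<^bsub>?P\<^esub> (Suc k)) UNIV"
    moreover have "finite (range (\<lambda>k. A [^]\<^bsub>?P\<^esub> (Suc k)))"
    proof (rule finite_subset)
      show "range (\<lambda>k. A [^]\<^bsub>?P\<^esub> (Suc k)) \<subseteq> Pow (carrier G)"
        by (intro image_subsetI) (metis P.nat_pow_closed AP PowI power_monoid_simps(1))
    qed (simp add: fin)
    ultimately show False using finite_imageD infinite_UNIV_nat by blast
  qed
  then obtain i p :: nat where ip: "i \<ge> 1" "p \<ge> 1" "A [^]\<^bsub>?P\<^esub> (i + p) = A [^]\<^bsub>?P\<^esub> i"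
  proof -
    obtain a b where ab: "A [^]\<^bsub>?P\<^esub> (Suc a) = A [^]\<^bsub>?P\<^esub> (Suc b)" "a < b"
      using \<open>\<not> inj_on _ UNIV\<close> unfolding inj_on_def by (metis linorder_neqE_nat)
    show thesis by (rule that[of "Suc a" "b - a"]) (use ab in auto)
  qed
  have period: "A [^]\<^bsub>?P\<^esub> (n + p) = A [^]\<^bsub>?P\<^esub> n" if "n \<ge> i" for n
  proof -
    have "A [^]\<^bsub>?P\<^esub> (n + p) = A [^]\<^bsub>?P\<^esub> (n - i) \<otimes>\<^bsub>?P\<^esub> A [^]\<^bsub>?P\<^esub> (i + p)"
      using that AP by (subst P.nat_pow_mult) simp_all
    also have "\<dots> = A [^]\<^bsub>?P\<^esub> n" unfolding ip(3) using that AP by (subst P.nat_pow_mult) simp_all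
    finally show ?thesis .
  qed
  have periods: "A [^]\<^bsub>?P\<^esub> (i * p + m * p) = A [^]\<^bsub>?P\<^esub> (i * p)" for m
  proof (induction m)
    case (Suc m)
    have "i * p \<ge> i" using mult_le_mono2[OF ip(2), of i] by simp
    then have "A [^]\<^bsub>?P\<^esub> ((i * p + m * p) + p) = A [^]\<^bsub>?P\<^esub> (i * p + m * p)"
      by (intro period trans_le_add1)
    then show ?case using Suc by (simp add: algebra_simps)
  qed simp
  \<comment> \<open>The exponent \<open>i * p\<close> is at least \<open>i\<close>, and adding the
    period \<open>p\<close> another \<open>i\<close> times doubles it, which is the squaring of the
    power.\<close>
  have Q: "?Q (A [^]\<^bsub>?P\<^esub> (i * p))"
  proof
    have "i * p \<ge> 1" using ip(1,2) by simp
    then show "\<exists>k\<ge>1. A [^]\<^bsub>?P\<^esub> (i * p) = set_power G A k" unfolding set_power_eq by blast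
    show "A [^]\<^bsub>?P\<^esub> (i * p) <#> A [^]\<^bsub>?P\<^esub> (i * p) = A [^]\<^bsub>?P\<^esub> (i * p)"
      using periods[of i] AP P.nat_pow_mult[OF AP, of "i * p" "i * p"]
      by (simp add: power_monoid_simps)
  qed
  have "?Q (idempotent_power G A)"
    unfolding idempotent_power_def by (rule theI[of ?Q, OF Q unique[OF _ Q]])
  then show "\<exists>k\<ge>1::nat. idempotent_power G A = A [^]\<^bsub>?P\<^esub> k"
    and "idempotent_power G A <#> idempotent_power G A = idempotent_power G A"
    by (simp_all add: set_power_eq)
qed

context glider_chain
begin

context
  fixes A assumes A: "A \<in> carrier P"
begin

lemma nonempty_subset: "A \<noteq> {}" "A \<subseteq> carrier G"
  using A by (simp_all add: power_monoid_simps)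

lemma idempotent_power_P: "idempotent_power G A \<in> carrier P"
  using idempotent_power(1)[OF fin nonempty_subset] comm_monoid.axioms(1)[OF power_monoid_comm_monoid] A
  by (metis monoid.nat_pow_closed)

lemma idempotent_power_subgroup: "subgroup (idempotent_power G A) G"
  using idempotent_power(2)[OF fin nonempty_subset] idempotent_power_P fin
  by (intro finite_mult_closed_subgroup) (auto simp: power_monoid_simps intro: finite_subset)

text \<open>Write \<open>N\<close> as A^(k-1) times \<open>A\<close> and fix \<open>y\<close> in
  A^(k-1). Then \<open>y \<otimes> a\<close> and \<open>y \<otimes> x\<close> both lie in the
  subgroup \<open>N\<close>, so \<open>a\<close> and \<open>x\<close> differ by an element of
  \<open>N\<close>.\<close>

lemma subset_coset_idempotent_power:
  assumes a: "a \<in> A"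
  shows "A \<subseteq> a <# idempotent_power G A"
proof
  interpret P: comm_monoid P by (rule power_monoid_comm_monoid)
  let ?N = "idempotent_power G A"
  note N = idempotent_power_subgroup
  fix x assume x: "x \<in> A"
  obtain k :: nat where "k \<ge> 1" "?N = A [^]\<^bsub>P\<^esub> k" using idempotent_power(1)[OF fin nonempty_subset] by auto
  then have k: "?N = A [^]\<^bsub>P\<^esub> (k - 1) <#> A" by (cases k) (simp_all add: power_monoid_simps)
  have "A [^]\<^bsub>P\<^esub> (k - 1) \<in> carrier P" using A by simp
  then obtain y where y: "y \<in> A [^]\<^bsub>P\<^esub> (k - 1)" "y \<in> carrier G"
    by (auto simp: power_monoid_simps)
  have yN: "y \<otimes> a \<in> ?N" "y \<otimes> x \<in> ?N" using k y x a by (auto simp: set_mult_def)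
  have ax: "a \<in> carrier G" "x \<in> carrier G" using a x nonempty_subset by auto
  have "inv (y \<otimes> a) \<otimes> (y \<otimes> x) \<in> ?N"
    using yN N by (simp add: subgroup.m_closed subgroup.m_inv_closed)
  moreover have "a \<otimes> (inv (y \<otimes> a) \<otimes> (y \<otimes> x)) = x"
  proof -
    have "y \<otimes> (a \<otimes> (inv (y \<otimes> a) \<otimes> (y \<otimes> x))) = (y \<otimes> a) \<otimes> inv (y \<otimes> a) \<otimes> (y \<otimes> x)"
      using ax y(2) by (simp only: m_assoc m_closed inv_closed)
    also have "\<dots> = y \<otimes> x" using ax y(2) by simp
    finally have eq: "y \<otimes> (a \<otimes> (inv (y \<otimes> a) \<otimes> (y \<otimes> x))) = y \<otimes> x" .
    show ?thesis by (rule iffD1[OF Units_l_cancel eq]) (use ax y(2) in auto)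
  qed
  ultimately show "x \<in> a <# ?N" unfolding l_coset_def by blast
qed

text \<open>If \<open>A\<close> lies in a coset of \<open>L\<close>, so does each power of
  \<open>A\<close>. The idempotent power contains the unit, so the coset containing it is
  \<open>L\<close> itself.\<close>

lemma idempotent_power_subset:
  assumes L: "subgroup L G" and a: "a \<in> A" "A \<subseteq> L #> a"
  shows "idempotent_power G A \<subseteq> L"
proof -
  interpret P: comm_monoid P by (rule power_monoid_comm_monoid)
  have ac: "a \<in> carrier G" using a nonempty_subset by auto
  \<comment> \<open>The membership of \<open>a [^] n\<close> is carried along because the induction
    step through \<open>set_mult_subset_coset_iff\<close> needs a point of each factor.\<close>
  have pow: "a [^] n \<in> A [^]\<^bsub>P\<^esub> n \<and> A [^]\<^bsub>P\<^esub> n \<subseteq> L #> (a [^] n)" for n :: nat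
  proof (induction n)
    case 0
    show ?case using L by (simp add: power_monoid_simps subgroup.subset subgroup.one_closed)
  next
    case (Suc n)
    have "A [^]\<^bsub>P\<^esub> n \<subseteq> carrier G" using P.nat_pow_closed[OF A] by (simp add: power_monoid_simps)
    then show ?case
      using Suc set_mult_subset_coset_iff[OF L, of "A [^]\<^bsub>P\<^esub> n" "a [^] n" A a] nonempty_subset a
      by (auto simp: power_monoid_simps set_mult_def)
  qed
  obtain k :: nat where k: "idempotent_power G A = A [^]\<^bsub>P\<^esub> k" using idempotent_power(1)[OF fin nonempty_subset] by auto
  have "\<one> \<in> L #> (a [^] k)"
    using pow[of k] k subgroup.one_closed[OF idempotent_power_subgroup] by auto
  from repr_independence[OF this _ L] have "L #> (a [^] k) = L"
    using ac L by (simp add: subgroup.subset)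
  then show ?thesis using pow[of k] k by simp
qed

end

section \<open>Coset hulls of subsets\<close>

text \<open>All points of \<open>A\<close> lie in the same coset of its idempotent power, so the
  choice merely names a representative.\<close>

definition coset_hull where "coset_hull A = (SOME a. a \<in> A) <# idempotent_power G A"

definition "cosets = {D. \<exists>L. subgroup L G \<and> D \<in> rcosets L}"

lemma l_coset_eq_r_coset: "a \<in> carrier G \<Longrightarrow> N \<subseteq> carrier G \<Longrightarrow> a <# N = N #> a"
  by (simp add: l_coset_eq_set_mult r_coset_eq_set_mult set_mult_comm)

lemma coset_hull_eq:
  assumes "A \<in> carrier P"
  obtains a where "a \<in> A" "coset_hull A = a <# idempotent_power G A" "coset_hull A = idempotent_power G A #> a"
proof -
  have "(SOME a. a \<in> A) \<in> A" using nonempty_subset[OF assms] by (simp add: some_in_eq)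
  moreover from this have "(SOME a. a \<in> A) \<in> carrier G" using nonempty_subset[OF assms] by auto
  ultimately show thesis using that
    by (simp add: coset_hull_def l_coset_eq_r_coset subgroup.subset[OF idempotent_power_subgroup[OF assms]])
qed

lemma coset_hull_cosets:
  assumes A: "A \<in> carrier P"
  shows "coset_hull A \<in> cosets"
proof -
  obtain a where a: "a \<in> A" "coset_hull A = idempotent_power G A #> a" using A by (rule coset_hull_eq)
  note N = idempotent_power_subgroup[OF A]
  have "a \<in> carrier G" using a(1) nonempty_subset[OF A] by auto
  then have "coset_hull A \<in> rcosets (idempotent_power G A)"
    unfolding a(2) by (rule rcosetsI[OF subgroup.subset[OF N]])
  with N show ?thesis unfolding cosets_def by blast
qed

lemma cosets_P: "D \<in> cosets \<Longrightarrow> D \<in> carrier P"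
  unfolding cosets_def power_monoid_simps
  using subgroup.rcosets_non_empty subgroup.rcosets_carrier is_group by blast

text \<open>The reason why coset parts do not separate \<open>A\<close> from its hull: if
  \<open>A\<close> lies in a coset \<open>L #> a\<close>, then \<open>N\<close> lies in
  \<open>L\<close>, and therefore \<open>a <# N\<close> lies in the same coset.\<close>

lemma coset_subset_iff:
  assumes A: "A \<in> carrier P" and N: "N = idempotent_power G A" and a: "a \<in> A"
    and L: "subgroup L G" and D: "D \<in> rcosets L"
  shows "A \<subseteq> D \<longleftrightarrow> a <# N \<subseteq> D"
proof
  assume "a <# N \<subseteq> D"
  then show "A \<subseteq> D" using subset_coset_idempotent_power[OF A a] N by auto
next
  assume AD: "A \<subseteq> D"
  have ac: "a \<in> carrier G" using a nonempty_subset A by auto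
  obtain x where x: "x \<in> carrier G" "D = L #> x" using D by (auto simp: RCOSETS_def)
  have "a \<in> L #> x" using AD a x(2) by auto
  from repr_independence[OF this x(1) L] x(2) have D_eq: "D = L #> a" by simp
  then have "N \<subseteq> L" unfolding N using idempotent_power_subset[OF A L a] AD by simp
  then have "N #> a \<subseteq> D" unfolding D_eq by (auto simp: r_coset_def)
  then show "a <# N \<subseteq> D"
    using l_coset_eq_r_coset[OF ac] subgroup.subset[OF idempotent_power_subgroup[OF A]] N by simp
qed

lemma coset_hull_subset_iff:
  assumes "A \<in> carrier P" and "D \<in> cosets"
  shows "A \<subseteq> D \<longleftrightarrow> coset_hull A \<subseteq> D"
proof -
  obtain L where "subgroup L G" "D \<in> rcosets L" using assms(2) by (auto simp: cosets_def)
  moreover obtain a where "a \<in> A" "coset_hull A = a <# idempotent_power G A"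
    using assms(1) by (rule coset_hull_eq)
  ultimately show ?thesis using coset_subset_iff[OF assms(1) refl] by simp
qed


section \<open>Minimal subgroups\<close>

text \<open>Among the nontrivial subgroups inside \<open>S\<close>, one of least cardinality is
  minimal.\<close>

lemma (in -) minimal_subgroup_exists:
  assumes "finite (carrier K)" "subgroup S K" "S \<noteq> {\<one>\<^bsub>K\<^esub>}"
  obtains M where "M \<in> minimal_subgroups K" "M \<subseteq> S"
proof -
  let ?Q = "\<lambda>M. subgroup M K \<and> M \<noteq> {\<one>\<^bsub>K\<^esub>} \<and> M \<subseteq> S"
  obtain M where M: "?Q M" "\<And>L. ?Q L \<Longrightarrow> card M \<le> card L"
    using ex_has_least_nat[of ?Q S card] assms by blast
  have "L = M" if "subgroup L K" "L \<noteq> {\<one>\<^bsub>K\<^esub>}" "L \<subseteq> M" for L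
  proof (rule card_seteq)
    show "finite M" using M(1) assms(1) finite_subset subgroup.subset by blast
  qed (use M that in auto)
  then show thesis using M(1) by (intro that) (auto simp: minimal_subgroups_def)
qed

text \<open>The lift contains the unit through \<open>N\<close>, so
  \<open>coset_part_gen_one\<close> will apply to it. It exceeds \<open>N\<close> because a
  nontrivial subgroup of the quotient has a member other than the coset \<open>N\<close>.\<close>

lemma minimal_lift:
  assumes N: "subgroup N G" and M: "M \<in> minimal_subgroups (G Mod N)"
  shows "subgroup_lift G N M \<in> carrier P" "N \<subseteq> subgroup_lift G N M" "\<not> subgroup_lift G N M \<subseteq> N"
proof -
  have sub: "subgroup M (G Mod N)" and nt: "M \<noteq> {N}"
    using M by (simp_all add: minimal_subgroups_def)
  have NM: "N \<in> M" using subgroup.one_closed[OF sub] by simp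
  show NS: "N \<subseteq> subgroup_lift G N M"
    using NM N subgroup.mem_carrier[OF N] by (auto simp: subgroup_lift_def coset_join2)
  then show "subgroup_lift G N M \<in> carrier P"
    using subgroup.one_closed[OF N] by (auto simp: power_monoid_simps subgroup_lift_def)
  obtain D where D: "D \<in> M" "D \<noteq> N" using nt NM by blast
  then have "D \<in> rcosets N" using subgroup.subset[OF sub] by (auto simp: FactGroup_def)
  then obtain g where g: "g \<in> carrier G" "D = N #> g" by (auto simp: RCOSETS_def)
  then have "g \<in> subgroup_lift G N M" "g \<notin> N" using D N by (auto simp: subgroup_lift_def coset_join2)
  then show "\<not> subgroup_lift G N M \<subseteq> N" by auto
qed

text \<open>The image of \<open>L\<close> in \<open>G Mod N\<close> is a nontrivial subgroup and
  contains a minimal one. The lift of the latter stays in \<open>L\<close>, since \<open>L\<close>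
  contains \<open>N\<close> and is thus the full preimage of its image.\<close>

lemma minimal_lift_subset:
  assumes N: "subgroup N G" and L: "subgroup L G" and NL: "N \<subseteq> L" "N \<noteq> L"
  obtains M where "M \<in> minimal_subgroups (G Mod N)" "subgroup_lift G N M \<subseteq> L"
proof -
  interpret N: normal N G by (rule subgroup_imp_normal[OF N])
  interpret h: group_hom G "G Mod N" "\<lambda>g. N #> g"
    by (intro group_hom.intro group_hom_axioms.intro is_group N.factorgroup_is_group N.r_coset_hom_Mod)
  let ?S = "(\<lambda>g. N #> g) ` L"
  have "subgroup ?S (G Mod N)" by (rule h.subgroup_img_is_subgroup[OF L])
  moreover have "?S \<noteq> {\<one>\<^bsub>G Mod N\<^esub>}"
  proof
    assume "?S = {\<one>\<^bsub>G Mod N\<^esub>}"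
    then have "g \<in> N" if "g \<in> L" for g
      using that coset_join1[OF _ subgroup.mem_carrier[OF L that] N] by auto
    then show False using NL by auto
  qed
  moreover have "finite (carrier (G Mod N))" using finite_rcosets[OF N] by (simp add: FactGroup_def)
  ultimately obtain M where M: "M \<in> minimal_subgroups (G Mod N)" "M \<subseteq> ?S"
    using minimal_subgroup_exists by blast
  have "subgroup_lift G N M \<subseteq> L"
  proof
    fix g assume "g \<in> subgroup_lift G N M"
    then obtain l where gl: "g \<in> carrier G" "l \<in> L" "N #> g = N #> l"
      using M(2) by (auto simp: subgroup_lift_def)
    then have "g \<in> N #> l" using rcos_self[OF gl(1) N] by simp
    then show "g \<in> L" using gl(2) NL(1) subgroup.m_closed[OF L] by (auto simp: r_coset_def)
  qed
  with M show thesis by (intro that)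
qed

end

context glider_chain
begin

section \<open>Surjectivity onto the sum of the group algebras\<close>

lemma subgroup_P: "subgroup N G \<Longrightarrow> N \<in> carrier P"
  using subgroup.one_closed subgroup.subset by (fastforce simp: power_monoid_simps)

lemma coset_algebra_cring: "subgroup L G \<Longrightarrow> cring (group_algebra (G Mod L))"
  using finite_rcosets
  by (intro group_algebra_cring comm_group.axioms(1) abelian_FactGroup) (simp_all add: FactGroup_def)

lemma coset_part_gen_eq:
  assumes L: "subgroup L G" and A: "A \<subseteq> carrier G" "a \<in> A"
  shows "coset_part L (gen A) = (if A \<subseteq> L #> a then chi (L #> a) else (\<lambda>D. 0))"
proof -
  have AP: "A \<in> carrier P" using A by (auto simp: power_monoid_simps)
  have "coset_part L (gen A) D = (if A \<subseteq> L #> a then chi (L #> a) D else 0)" for D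
    unfolding coset_part_gen[OF AP L] coset_indicator[OF L A, symmetric] using A(2) by auto
  then show ?thesis by (simp add: fun_eq_iff)
qed

text \<open>A coset of \<open>L\<close> that contains the unit is \<open>L\<close>, the unit of the
  quotient; so sets containing the unit are sent to 1 or 0.\<close>

lemma coset_part_gen_one:
  assumes L: "subgroup L G" and A: "A \<in> carrier P" "\<one> \<in> A"
  shows "coset_part L (gen A) =
    (if A \<subseteq> L then \<one>\<^bsub>group_algebra (G Mod L)\<^esub> else \<zero>\<^bsub>group_algebra (G Mod L)\<^esub>)"
  using coset_part_gen_eq[OF L _ A(2)] A(1) subgroup.subset[OF L]
  by (simp add: power_monoid_simps group_algebra_simps)

lemma coset_part_gen_coset:
  assumes L: "subgroup L G" and D: "D \<in> rcosets L"
  shows "coset_part L (gen D) = chi D"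
proof -
  obtain a where a: "a \<in> carrier G" "D = L #> a" using D by (auto simp: RCOSETS_def)
  then show ?thesis
    using coset_part_gen_eq[OF L _ rcos_self[OF a(1) L]] L
    by (simp add: r_coset_subset_G subgroup.subset)
qed

text \<open>A representative of the prescribed product in the uncontracted corner;
  \<open>proj_unit_elem\<close> identifies its class.\<close>

definition unit_elem where
  "unit_elem N = (\<Otimes>\<^bsub>C\<^esub> M \<in> minimal_subgroups (G Mod N). gen N \<ominus>\<^bsub>C\<^esub> gen (subgroup_lift G N M))"

lemma finite_minimal_subgroups:
  assumes N: "subgroup N G"
  shows "finite (minimal_subgroups (G Mod N))"
proof (rule finite_subset)
  show "minimal_subgroups (G Mod N) \<subseteq> Pow (rcosets N)"
    using subgroup.subset by (fastforce simp: minimal_subgroups_def FactGroup_def)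
qed (simp add: finite_rcosets[OF N])

lemma factor_carrier:
  assumes "subgroup N G" "M \<in> minimal_subgroups (G Mod N)"
  shows "gen N \<ominus>\<^bsub>C\<^esub> gen (subgroup_lift G N M) \<in> carrier C"
proof -
  interpret C: cring C by (rule C_cring)
  show ?thesis using assms by (simp add: gen_carrier subgroup_P minimal_lift)
qed

lemma unit_elem_carrier:
  assumes "subgroup N G"
  shows "unit_elem N \<in> carrier C"
proof -
  interpret C: cring C by (rule C_cring)
  show ?thesis unfolding unit_elem_def using factor_carrier[OF assms] by (intro C.finprod_closed) auto
qed

text \<open>If \<open>L = N\<close> all factors are \<open>1\<close>; if \<open>N\<close> is properly contained in \<open>L\<close>, the factor of a
  minimal subgroup inside \<open>L / N\<close> vanishes; and if \<open>N\<close> is not contained in \<open>L\<close>, all factors do.\<close>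
lemma coset_part_unit_elem:
  assumes N: "N \<in> proper_subgroups G" and L: "L \<in> proper_subgroups G"
  shows "coset_part L (unit_elem N) =
    (if L = N then \<one>\<^bsub>group_algebra (G Mod L)\<^esub> else \<zero>\<^bsub>group_algebra (G Mod L)\<^esub>)"
proof -
  have sub: "subgroup N G" "subgroup L G" "N \<noteq> carrier G"
    using N L by (simp_all add: proper_subgroups_def)
  interpret C: cring C by (rule C_cring)
  interpret Q: cring "group_algebra (G Mod L)" by (rule coset_algebra_cring[OF sub(2)])
  interpret h: ring_hom_cring C "group_algebra (G Mod L)" "coset_part L"
    by (intro ring_hom_cring.intro ring_hom_cring_axioms.intro C_cring Q.is_cring
        coset_part_hom_C[OF sub(2)])
  let ?Q = "group_algebra (G Mod L)" and ?S = "minimal_subgroups (G Mod N)"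
  let ?f = "\<lambda>M. gen N \<ominus>\<^bsub>C\<^esub> gen (subgroup_lift G N M)"
  have f: "?f \<in> ?S \<rightarrow> carrier C" using factor_carrier[OF sub(1)] by auto
  have prod: "coset_part L (unit_elem N) = finprod ?Q (coset_part L \<circ> ?f) ?S"
    unfolding unit_elem_def using f by (subst h.hom_finprod) (simp_all add: comp_def)
  have factor: "(coset_part L \<circ> ?f) M = (if N \<subseteq> L then \<one>\<^bsub>?Q\<^esub> else \<zero>\<^bsub>?Q\<^esub>) \<ominus>\<^bsub>?Q\<^esub>
      (if subgroup_lift G N M \<subseteq> L then \<one>\<^bsub>?Q\<^esub> else \<zero>\<^bsub>?Q\<^esub>)" if M: "M \<in> ?S" for M
  proof -
    note lift = minimal_lift[OF sub(1) M]
    have one: "\<one> \<in> N" using sub(1) by (rule subgroup.one_closed)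
    have "(coset_part L \<circ> ?f) M =
        coset_part L (gen N) \<ominus>\<^bsub>?Q\<^esub> coset_part L (gen (subgroup_lift G N M))"
      using lift by (simp add: a_minus_def gen_carrier subgroup_P sub)
    moreover have "\<one> \<in> subgroup_lift G N M" using one lift(2) by auto
    ultimately show ?thesis
      by (simp only: coset_part_gen_one[OF sub(2) subgroup_P[OF sub(1)] one]
          coset_part_gen_one[OF sub(2) lift(1)])
  qed
  have fQ: "(coset_part L \<circ> ?f) \<in> ?S \<rightarrow> carrier ?Q" using f by (auto simp: Pi_def)
  show ?thesis
  proof (cases "L = N")
    case True
    have "(coset_part L \<circ> ?f) M = \<one>\<^bsub>?Q\<^esub>" if "M \<in> ?S" for M
    proof -
      have "N \<subseteq> L" "\<not> subgroup_lift G N M \<subseteq> L" using minimal_lift(3)[OF sub(1) that] True by auto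
      then show ?thesis unfolding factor[OF that] by (simp add: a_minus_def)
    qed
    then have "finprod ?Q (coset_part L \<circ> ?f) ?S = \<one>\<^bsub>?Q\<^esub>" by (rule Q.finprod_one_eqI)
    then show ?thesis unfolding prod using True by simp
  next
    case False
    have "\<exists>M\<in>?S. (coset_part L \<circ> ?f) M = \<zero>\<^bsub>?Q\<^esub>"
    proof (cases "N \<subseteq> L")
      case True
      obtain M where "M \<in> ?S" "subgroup_lift G N M \<subseteq> L"
        using minimal_lift_subset[OF sub(1,2) True] False by auto
      then show ?thesis using factor[of M] True by (auto simp: a_minus_def Q.r_neg)
    next
      case NL: False
      \<comment> \<open>Properness of \<open>N\<close> provides a minimal lift inside
        \<open>G\<close>, so the product is not empty; its factor is sent to 0 - 0.\<close>
      obtain M where M: "M \<in> ?S"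
        using minimal_lift_subset[OF sub(1) subgroup_self subgroup.subset[OF sub(1)] sub(3)] by auto
      then have "\<not> subgroup_lift G N M \<subseteq> L" using minimal_lift(2)[OF sub(1) M] NL by auto
      then show ?thesis using factor[OF M] NL M by (auto simp: a_minus_def)
    qed
    then show ?thesis
      unfolding prod using False Q.finprod_zero_factor[OF finite_minimal_subgroups[OF sub(1)] fQ] by auto
  qed
qed

abbreviation "D \<equiv> direct_sum_ring (proper_subgroups G) (\<lambda>N. group_algebra (G Mod N))"

definition coset_parts where "coset_parts x = (\<lambda>L\<in>proper_subgroups G. coset_part L x)"

lemma coset_parts_hom: "coset_parts \<in> ring_hom C D"
proof (rule ring_hom_memI)
  have h: "coset_part L \<in> ring_hom C (group_algebra (G Mod L))" if "L \<in> proper_subgroups G" for L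
    using that by (intro coset_part_hom_C) (simp add: proper_subgroups_def)
  show "coset_parts x \<in> carrier D" if "x \<in> carrier C" for x
    using ring_hom_closed[OF h that] by (auto simp: coset_parts_def direct_sum_ring_def)
  show "coset_parts (x \<otimes>\<^bsub>C\<^esub> y) = coset_parts x \<otimes>\<^bsub>D\<^esub> coset_parts y"
    if "x \<in> carrier C" "y \<in> carrier C" for x y
    using ring_hom_mult[OF h that] by (auto simp: coset_parts_def direct_sum_ring_def)
  show "coset_parts (x \<oplus>\<^bsub>C\<^esub> y) = coset_parts x \<oplus>\<^bsub>D\<^esub> coset_parts y"
    if "x \<in> carrier C" "y \<in> carrier C" for x y
    using ring_hom_add[OF h that] by (auto simp: coset_parts_def direct_sum_ring_def)
  show "coset_parts \<one>\<^bsub>C\<^esub> = \<one>\<^bsub>D\<^esub>"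
    using ring_hom_one[OF h] by (auto simp: coset_parts_def direct_sum_ring_def)
qed

lemma coset_parts_unit_elem:
  "N \<in> proper_subgroups G \<Longrightarrow> coset_parts (unit_elem N) =
    component_unit (proper_subgroups G) (\<lambda>N. group_algebra (G Mod N)) N"
  by (auto simp: coset_parts_def component_unit_def coset_part_unit_elem)

lemma finite_proper_subgroups: "finite (proper_subgroups G)"
  by (rule finite_subset[of _ "Pow (carrier G)"])
    (auto simp: proper_subgroups_def fin dest: subgroup.mem_carrier)

text \<open>The preimage of \<open>d\<close> weights \<open>unit_elem L\<close> times
  \<open>gen E\<close> with the coefficient of \<open>d\<close> at the coset \<open>E\<close> of
  \<open>L\<close>. The unit element cuts out the component of \<open>L\<close>, where
  \<open>gen E\<close> becomes the basis vector \<open>E\<close>.\<close>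

lemma coset_parts_surj: "carrier D \<subseteq> coset_parts ` carrier C"
proof
  interpret C: cring C by (rule C_cring)
  fix d assume d: "d \<in> carrier D"
  let ?S = "SIGMA L : proper_subgroups G. rcosets L"
  let ?v = "\<lambda>(L, E). unit_elem L \<otimes>\<^bsub>C\<^esub> gen E"
  have sub: "subgroup L G" if "L \<in> proper_subgroups G" for L
    using that by (simp add: proper_subgroups_def)
  have E: "E \<in> carrier P" if "subgroup L G" "E \<in> rcosets L" for L E
    using that by (intro cosets_P) (auto simp: cosets_def)
  have fin_S: "finite ?S" using finite_proper_subgroups finite_rcosets[OF sub] by (rule finite_SigmaI)
  define x where "x = (\<lambda>r. \<Sum>z\<in>?S. d (fst z) (snd z) * ?v z r)"
  have xC: "x \<in> carrier C"
    unfolding x_def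
    by (rule C_combination) (auto intro!: C.m_closed unit_elem_carrier gen_carrier sub E)
  have "coset_part L x = d L" if L: "L \<in> proper_subgroups G" for L
  proof
    fix j
    interpret Q: cring "group_algebra (G Mod L)" by (rule coset_algebra_cring[OF sub[OF L]])
    note h = coset_part_hom_C[OF sub[OF L]]
    have v: "coset_part L (?v (L', E)) j = (if (L', E) = (L, j) then 1 else 0)"
      if L': "L' \<in> proper_subgroups G" and E': "E \<in> rcosets L'" for L' E
    proof -
      have gE: "gen E \<in> carrier C" using E[OF sub[OF L'] E'] by (rule gen_carrier)
      have "coset_part L (?v (L', E)) = coset_part L (unit_elem L') \<otimes>\<^bsub>group_algebra (G Mod L)\<^esub>
          coset_part L (gen E)"
        using ring_hom_mult[OF h unit_elem_carrier[OF sub[OF L']] gE] by simp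
      also have "\<dots> = (if L = L' then coset_part L (gen E) else \<zero>\<^bsub>group_algebra (G Mod L)\<^esub>)"
        using Q.l_one[OF ring_hom_closed[OF h gE]] Q.l_null[OF ring_hom_closed[OF h gE]]
        by (auto simp: coset_part_unit_elem[OF L' L])
      finally show ?thesis
        using coset_part_gen_coset[OF sub[OF L'] E'] by (auto simp: group_algebra_simps chi_def)
    qed
    have "coset_part L x j = (\<Sum>z\<in>?S. d (fst z) (snd z) * coset_part L (?v z) j)"
      unfolding x_def by (simp only: part_combination)
    also have "\<dots> = (\<Sum>z\<in>?S. if z = (L, j) then d L j else 0)"
      by (rule sum.cong) (use v in \<open>auto split: if_splits\<close>)
    also have "\<dots> = (if j \<in> rcosets L then d L j else 0)"
      using fin_S L by simp
    also have "\<dots> = d L j"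
    proof -
      have "d L \<in> carrier (group_algebra (G Mod L))" using d L by (auto simp: direct_sum_ring_def)
      then show ?thesis by (auto simp: group_algebra_def structure_algebra_simps FactGroup_def)
    qed
    finally show "coset_part L x j = d L j" .
  qed
  then have "coset_parts x = d"
    using d by (auto simp: coset_parts_def direct_sum_ring_def PiE_def extensional_def restrict_def fun_eq_iff)
  then show "d \<in> coset_parts ` carrier C" using xC by auto
qed


section \<open>The kernel\<close>

text \<open>The coefficient of \<open>E\<close> after each set has been replaced by its coset
  hull.\<close>

definition coset_coeff where
  "coset_coeff x E = (\<Sum>A | A \<in> carrier P \<and> coset_hull A = E. long_part x A)"

text \<open>Moebius inversion over the poset of cosets.\<close>
lemma coset_coeff_zero:
  assumes ker: "\<And>L. L \<in> proper_subgroups G \<Longrightarrow> coset_part L x = (\<lambda>D. 0)"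
  shows "E \<in> cosets \<Longrightarrow> E \<noteq> carrier G \<Longrightarrow> coset_coeff x E = 0"
proof (induction "card E" arbitrary: E rule: less_induct)
  case less
  have E_sub: "E \<subseteq> carrier G" using cosets_P[OF less.prems(1)] by (simp add: power_monoid_simps)
  then have fin_E: "finite E" using fin by (rule finite_subset)
  obtain L where L: "subgroup L G" "E \<in> rcosets L" using less.prems(1) by (auto simp: cosets_def)
  have "L \<noteq> carrier G"
  proof
    assume "L = carrier G"
    moreover obtain a where "a \<in> carrier G" "E = L #> a" using L(2) by (auto simp: RCOSETS_def)
    ultimately show False using less.prems(2) by (simp add: coset_join2 subgroup_self)
  qed
  then have "L \<in> proper_subgroups G" using L by (simp add: proper_subgroups_def)
  then have "0 = coset_part L x E" by (simp add: ker)
  also have "\<dots> = (\<Sum>A | A \<in> carrier P \<and> A \<subseteq> E. long_part x A)" by (rule coset_part_eq[OF L(2)])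
  also have "\<dots> = (\<Sum>A | A \<in> carrier P \<and> coset_hull A \<subseteq> E. long_part x A)"
    using coset_hull_subset_iff[OF _ less.prems(1)] by (intro sum.cong) auto
  \<comment> \<open>Grouping by hulls gives the sum of the coefficients of all cosets inside
    \<open>E\<close>, the relation to be inverted.\<close>
  also have "\<dots> = (\<Sum>F | F \<in> cosets \<and> F \<subseteq> E.
      \<Sum>A | A \<in> {A. A \<in> carrier P \<and> coset_hull A \<subseteq> E} \<and> coset_hull A = F. long_part x A)"
  proof (rule sum.group[symmetric])
    show "finite {F \<in> cosets. F \<subseteq> E}" using fin_E by (auto intro: finite_subset[of _ "Pow E"])
    show "coset_hull ` {A \<in> carrier P. coset_hull A \<subseteq> E} \<subseteq> {F \<in> cosets. F \<subseteq> E}"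
      using coset_hull_cosets by auto
  qed (simp add: finite_P)
  also have "\<dots> = (\<Sum>F | F \<in> cosets \<and> F \<subseteq> E. coset_coeff x F)"
    unfolding coset_coeff_def by (intro sum.cong) auto
  \<comment> \<open>The induction hypothesis removes the cosets properly contained in
    \<open>E\<close>.\<close>
  also have "\<dots> = (\<Sum>F | F \<in> cosets \<and> F \<subseteq> E. if F = E then coset_coeff x E else 0)"
  proof (rule sum.cong)
    fix F assume F: "F \<in> {F \<in> cosets. F \<subseteq> E}"
    have "coset_coeff x F = 0" if "F \<noteq> E"
    proof (rule less.hyps)
      show "card F < card E" using F that fin_E by (intro psubset_card_mono) auto
      show "F \<noteq> carrier G" using F that E_sub by auto
    qed (use F in simp)
    then show "coset_coeff x F = (if F = E then coset_coeff x E else 0)" by simp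
  qed simp
  also have "\<dots> = coset_coeff x E"
    using less.prems(1) fin_E finite_subset[of "{F \<in> cosets. F \<subseteq> E}" "Pow E"] by (subst sum.delta) auto
  finally show ?case by simp
qed

text \<open>Replacing every set by its hull changes \<open>x\<close> by differences lying in
  \<open>K\<close> and leaves a combination of cosets. By \<open>coset_coeff_zero\<close> at most
  the term at \<open>G\<close> survives, and it lies in \<open>K\<close> too. The ideal is arbitrary
  so that the preimage of \<open>I\<close> can be inserted.\<close>

lemma kernel_subset_ideal:
  assumes K: "ideal K C" and G: "gen (carrier G) \<in> K"
    and hull: "\<And>A. A \<in> carrier P \<Longrightarrow> gen A \<ominus>\<^bsub>C\<^esub> gen (coset_hull A) \<in> K"
    and x: "x \<in> carrier C" and ker: "\<And>L. L \<in> proper_subgroups G \<Longrightarrow> coset_part L x = (\<lambda>D. 0)"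
  shows "x \<in> K"
proof -
  interpret C: cring C by (rule C_cring)
  interpret K: ideal K C by fact
  have hP: "coset_hull A \<in> carrier P" if "A \<in> carrier P" for A
    using coset_hull_cosets[OF that] by (rule cosets_P)
  \<comment> \<open>The coefficient at \<open>G\<close> is not controlled by proper subgroups, so
    sets with hull \<open>G\<close> are not replaced; their \<open>gen\<close> already lies in
    \<open>K\<close>.\<close>
  define v where "v A = (\<lambda>r. gen A r - (if coset_hull A = carrier G then 0 else gen (coset_hull A) r))" for A
  have vK: "v A \<in> K" if A: "A \<in> carrier P" for A
  proof (cases "coset_hull A = carrier G")
    case True
    have gA: "gen A \<in> carrier C" "gen (carrier G) \<in> carrier C"
      using A hP[OF A] True by (simp_all add: gen_carrier)
    have "(gen A \<ominus>\<^bsub>C\<^esub> gen (carrier G)) \<oplus>\<^bsub>C\<^esub> gen (carrier G) \<in> K"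
      using hull[OF A] G True by (intro K.a_closed) simp_all
    moreover have "(gen A \<ominus>\<^bsub>C\<^esub> gen (carrier G)) \<oplus>\<^bsub>C\<^esub> gen (carrier G) = v A"
      using gA True by (simp add: C_minus C_simps v_def)
    ultimately show ?thesis by simp
  next
    case False
    then have "v A = gen A \<ominus>\<^bsub>C\<^esub> gen (coset_hull A)"
      using A hP by (simp add: C_minus gen_carrier v_def)
    then show ?thesis using hull[OF A] by simp
  qed
  define z where "z = (\<lambda>r. \<Sum>A\<in>carrier P. long_part x A * v A r)"
  have zK: "z \<in> K" unfolding z_def using vK by (rule ideal_combination[OF K])
  have "long_part z j = long_part x j" for j
  proof -
    have long_v: "long_part (v A) j = chi A j - (if coset_hull A = carrier G then 0 else chi (coset_hull A) j)"
      if "A \<in> carrier P" for A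
      unfolding v_def part_diff using that hP[OF that]
      by (cases "coset_hull A = carrier G") (simp_all add: long_part_gen, simp add: long_part_def)
    have "long_part z j = (\<Sum>A\<in>carrier P. long_part x A * long_part (v A) j)"
      unfolding z_def by (simp only: part_combination)
    \<comment> \<open>The subtracted sum collects the sets with hull \<open>j\<close>; it is
      \<open>coset_coeff x j\<close> and vanishes.\<close>
    also have "\<dots> = (\<Sum>A\<in>carrier P. long_part x A * chi A j) -
        (\<Sum>A\<in>carrier P. if coset_hull A = j \<and> j \<noteq> carrier G then long_part x A else 0)"
      unfolding sum_subtractf[symmetric] by (rule sum.cong) (auto simp: long_v right_diff_distrib chi_def)
    also have "(\<Sum>A\<in>carrier P. long_part x A * chi A j) = (\<Sum>A\<in>carrier P. if A = j then long_part x A else 0)"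
      by (rule sum.cong) (auto simp: chi_def)
    also have "\<dots> = long_part x j" by (simp add: finite_P long_part_eq)
    also have "(\<Sum>A\<in>carrier P. if coset_hull A = j \<and> j \<noteq> carrier G then long_part x A else 0) =
        (if j \<noteq> carrier G then coset_coeff x j else 0)"
      by (simp add: coset_coeff_def sum.If_cases finite_P Int_def)
    also have "\<dots> = 0"
    proof (cases "j \<in> cosets")
      case True
      then show ?thesis using coset_coeff_zero[OF ker] by simp
    next
      case False
      then have E: "{A. A \<in> carrier P \<and> coset_hull A = j} = {}" using coset_hull_cosets by auto
      show ?thesis unfolding coset_coeff_def E by simp
    qed
    finally show ?thesis by simp
  qed
  then have "z = x" using K.Icarr[OF zK] x by (intro C_inj) auto
  then show ?thesis using zK by simp
qed

section \<open>The contraction and the ideal \<open>I\<close> as the common kernel of the coset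
  parts\<close>

abbreviation "J \<equiv> contraction_ideal G H \<pi>"
abbreviation "T \<equiv> glider_T G H \<pi>"
abbreviation "I \<equiv> glider_ideal G H \<pi>"

lemma carrier_P: "carrier G \<in> carrier P"
  using one_closed by (auto simp: power_monoid_simps)

lemma J_eq: "J = Idl\<^bsub>C\<^esub> {gen (carrier G)}"
  by (simp add: contraction_ideal_def gen_def)

lemma J_ideal: "ideal J C"
  unfolding J_eq using C_cring by (intro ring.genideal_ideal cring.axioms(1)) (simp_all add: gen_carrier carrier_P)

lemma proj_chi: "glider_proj G H \<pi> (chi (A, \<pi> ` A)) = J +>\<^bsub>C\<^esub> gen A"
  by (simp add: glider_proj_def gen_def)

lemma gen_minus:
  assumes "A \<in> carrier P" "B \<in> carrier P"
  shows "(chi (A, \<pi> ` A) \<ominus>\<^bsub>R\<^esub> chi (B, \<pi> ` B)) \<otimes>\<^bsub>R\<^esub> e = gen A \<ominus>\<^bsub>C\<^esub> gen B"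
proof -
  have "chi (A, \<pi> ` A) \<in> carrier R" "chi (B, \<pi> ` B) \<in> carrier R"
    using assms by (simp_all add: chi_carrier basis_long power_monoid_simps)
  then show ?thesis
    using assms by (simp add: C_minus gen_carrier R_minus)
      (simp add: gen_def R_simps left_diff_distrib sum_subtractf)
qed

text \<open>Since \<pi> is a homomorphism, the second component of each subtracted element is the
  \<pi>-image of its first, so both terms of a generator are classes of some
  \<open>gen\<close>.\<close>

lemma I_eq: "I = Idl\<^bsub>T\<^esub> {J +>\<^bsub>C\<^esub> (gen A \<ominus>\<^bsub>C\<^esub> gen (g <# idempotent_power G A)) | A g.
  A \<in> carrier P \<and> g \<in> A}"
proof -
  have "glider_proj G H \<pi> (chi (A, \<pi> ` A) \<ominus>\<^bsub>R\<^esub> chi (g <# N, \<pi> g <# (\<pi> ` N))) =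
      J +>\<^bsub>C\<^esub> (gen A \<ominus>\<^bsub>C\<^esub> gen (g <# N))"
    if A: "A \<noteq> {}" "A \<subseteq> carrier G" and N: "N = idempotent_power G A" and g: "g \<in> A" for A N g
  proof -
    have AP: "A \<in> carrier P" using A by (simp add: power_monoid_simps)
    have NP: "N \<noteq> {}" "N \<subseteq> carrier G" using idempotent_power_P[OF AP] N by (simp_all add: power_monoid_simps)
    have gG: "g \<in> carrier G" using A g by auto
    have "\<pi> g <# (\<pi> ` N) = \<pi> ` (g <# N)"
      using gG NP(2) by (simp add: l_coset_eq_set_mult pi_set_mult)
    moreover have "g <# N \<in> carrier P"
      using gG NP by (simp add: l_coset_eq_set_mult power_monoid_simps set_mult_nonempty set_mult_closed)
    ultimately show ?thesis using AP by (simp add: glider_proj_def gen_minus)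
  qed
  then have "{glider_proj G H \<pi> (chi (A, \<pi> ` A) \<ominus>\<^bsub>R\<^esub> chi (g <# N, \<pi> g <# (\<pi> ` N)))
      | A N g. A \<noteq> {} \<and> A \<subseteq> carrier G \<and> N = idempotent_power G A \<and> g \<in> A} =
    {J +>\<^bsub>C\<^esub> (gen A \<ominus>\<^bsub>C\<^esub> gen (g <# idempotent_power G A)) | A g. A \<in> carrier P \<and> g \<in> A}"
    unfolding power_monoid_simps by (intro Collect_cong) metis
  then show ?thesis by (simp add: glider_ideal_def)
qed

lemma lcoset_P:
  assumes A: "A \<in> carrier P" and g: "g \<in> A"
  shows "g <# idempotent_power G A \<in> carrier P"
proof -
  have "{g} \<subseteq> carrier G" using nonempty_subset[OF A] g by auto
  then show ?thesis
    using idempotent_power_P[OF A]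
    by (simp add: l_coset_eq_set_mult power_monoid_simps set_mult_nonempty set_mult_closed)
qed

lemma I_generators_carrier:
  "{J +>\<^bsub>C\<^esub> (gen A \<ominus>\<^bsub>C\<^esub> gen (g <# idempotent_power G A)) | A g. A \<in> carrier P \<and> g \<in> A} \<subseteq> carrier T"
proof -
  interpret C: cring C by (rule C_cring)
  interpret p: ring_hom_ring C T "(+>\<^bsub>C\<^esub>) J"
    unfolding glider_T_def by (rule ideal.rcos_ring_hom_ring[OF J_ideal])
  have "J +>\<^bsub>C\<^esub> (gen A \<ominus>\<^bsub>C\<^esub> gen (g <# idempotent_power G A)) \<in> carrier T"
    if "A \<in> carrier P" "g \<in> A" for A g
    using that by (intro p.hom_closed C.minus_closed gen_carrier lcoset_P)
  then show ?thesis by blast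
qed

lemma T_cring: "cring T"
  unfolding glider_T_def by (rule ideal.quotient_is_cring[OF J_ideal C_cring])

lemma I_ideal: "ideal I T"
  unfolding I_eq by (rule ring.genideal_ideal[OF cring.axioms(1)[OF T_cring] I_generators_carrier])

text \<open>A common zero of the coset parts is caught by \<open>kernel_subset_ideal\<close>.
  Conversely, for proper \<open>L\<close> the kernel of the coset part contains
  \<open>gen (carrier G)\<close> and all differences with hulls, hence everything that becomes zero
  in the two quotients.\<close>

lemma kernel:
  assumes x: "x \<in> carrier C"
  shows "J +>\<^bsub>C\<^esub> x \<in> I \<longleftrightarrow> (\<forall>L\<in>proper_subgroups G. coset_part L x = (\<lambda>D. 0))"
proof
  interpret C: cring C by (rule C_cring)
  interpret T: cring T by (rule T_cring)
  interpret J: ideal J C by (rule J_ideal)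
  interpret p: ring_hom_ring C T "(+>\<^bsub>C\<^esub>) J"
    unfolding glider_T_def by (rule ideal.rcos_ring_hom_ring[OF J_ideal])
  {
    assume ker: "\<forall>L\<in>proper_subgroups G. coset_part L x = (\<lambda>D. 0)"
    \<comment> \<open>The preimage of \<open>I\<close> in the corner, an ideal that contains both
      kinds of generators.\<close>
    let ?K = "{y \<in> carrier C. J +>\<^bsub>C\<^esub> y \<in> I}"
    have "x \<in> ?K"
    proof (rule kernel_subset_ideal[OF p.ideal_vimage[OF I_ideal] _ _ x])
      have "J +>\<^bsub>C\<^esub> gen (carrier G) = \<zero>\<^bsub>T\<^esub>"
        using C.a_rcos_zero[OF J_ideal] C.genideal_self'[OF gen_carrier[OF carrier_P]]
        by (simp add: J_eq glider_T_def FactRing_def)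
      then show "gen (carrier G) \<in> ?K"
        using additive_subgroup.zero_closed[OF ideal.axioms(1)[OF I_ideal]] carrier_P
        by (simp add: gen_carrier)
      show "gen A \<ominus>\<^bsub>C\<^esub> gen (coset_hull A) \<in> ?K" if A: "A \<in> carrier P" for A
      proof -
        obtain a where a: "a \<in> A" "coset_hull A = a <# idempotent_power G A" using A by (rule coset_hull_eq)
        have "J +>\<^bsub>C\<^esub> (gen A \<ominus>\<^bsub>C\<^esub> gen (coset_hull A)) \<in> I"
          unfolding I_eq a(2)
          by (rule subsetD[OF T.genideal_self[OF I_generators_carrier]]) (use A a(1) in blast)
        moreover have "gen (coset_hull A) \<in> carrier C"
          unfolding a(2) by (rule gen_carrier[OF lcoset_P[OF A a(1)]])
        ultimately show ?thesis using gen_carrier[OF A] by simp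
      qed
      show "coset_part L x = (\<lambda>D. 0)" if "L \<in> proper_subgroups G" for L
        using ker that by (rule bspec)
    qed
    then show "J +>\<^bsub>C\<^esub> x \<in> I" by simp
  }
  assume xI: "J +>\<^bsub>C\<^esub> x \<in> I"
  show "\<forall>L\<in>proper_subgroups G. coset_part L x = (\<lambda>D. 0)"
  proof
    fix L assume "L \<in> proper_subgroups G"
    then have L: "subgroup L G" "L \<noteq> carrier G" by (simp_all add: proper_subgroups_def)
    interpret Q: cring "group_algebra (G Mod L)" by (rule coset_algebra_cring[OF L(1)])
    interpret h: ring_hom_ring C "group_algebra (G Mod L)" "coset_part L"
      by (intro ring_hom_ringI2 C.ring_axioms Q.ring_axioms coset_part_hom_C[OF L(1)])
    let ?Z = "a_kernel C (group_algebra (G Mod L)) (coset_part L)"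
    have Z: "y \<in> ?Z \<longleftrightarrow> y \<in> carrier C \<and> coset_part L y = (\<lambda>D. 0)" for y
      unfolding a_kernel_def' group_algebra_simps by blast
    have Z_ideal: "ideal ?Z C" by (rule h.kernel_is_ideal)
    have "coset_part L (gen (carrier G)) = (\<lambda>D. 0)"
    proof -
      have "\<not> carrier G \<subseteq> L" using L subgroup.subset[OF L(1)] by auto
      then show ?thesis
        unfolding coset_part_gen_one[OF L(1) carrier_P one_closed] by (simp add: group_algebra_simps)
    qed
    then have JZ: "J \<subseteq> ?Z"
      unfolding J_eq using gen_carrier[OF carrier_P] by (intro C.genideal_minimal[OF Z_ideal]) (simp add: Z)
    \<comment> \<open>The image of \<open>?Z\<close> in the contracted corner is an ideal, so
      containment needs checking on the generators of \<open>I\<close> only.\<close>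
    have "I \<subseteq> (+>\<^bsub>C\<^esub>) J ` ?Z"
      unfolding I_eq
    proof (rule T.genideal_minimal)
      show "ideal ((+>\<^bsub>C\<^esub>) J ` ?Z) T"
        unfolding glider_T_def by (rule C.ring_ideal_imp_quot_ideal[OF J_ideal Z_ideal])
      have "gen A \<ominus>\<^bsub>C\<^esub> gen (g <# idempotent_power G A) \<in> ?Z" if A: "A \<in> carrier P" "g \<in> A" for A g
      proof -
        have "coset_part L (gen A) D = coset_part L (gen (g <# idempotent_power G A)) D" for D
          using coset_subset_iff[OF A(1) refl A(2) L(1), of D]
          by (cases "D \<in> rcosets L")
            (simp_all add: coset_part_gen[OF A(1) L(1)] coset_part_gen[OF lcoset_P[OF A] L(1)])
        moreover note c = gen_carrier[OF A(1)] gen_carrier[OF lcoset_P[OF A]]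
        ultimately have "coset_part L (gen A \<ominus>\<^bsub>C\<^esub> gen (g <# idempotent_power G A)) = (\<lambda>D. 0)"
          unfolding C_minus[OF c] part_diff by simp
        then show ?thesis using C.minus_closed[OF c] by (simp only: Z)
      qed
      then show "{J +>\<^bsub>C\<^esub> (gen A \<ominus>\<^bsub>C\<^esub> gen (g <# idempotent_power G A)) | A g. A \<in> carrier P \<and> g \<in> A}
          \<subseteq> (+>\<^bsub>C\<^esub>) J ` ?Z" by (auto simp only:)
    qed
    from subsetD[OF this xI] obtain z where z: "J +>\<^bsub>C\<^esub> x = J +>\<^bsub>C\<^esub> z" "z \<in> ?Z"
      by (rule imageE)
    from this(2) have zC: "z \<in> carrier C" by (simp only: Z)
    \<comment> \<open>So far \<open>x\<close> is congruent modulo \<open>J\<close> to an element of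
      \<open>?Z\<close>; since \<open>J\<close> lies in \<open>?Z\<close>, so does
      \<open>x\<close>.\<close>
    have "x \<ominus>\<^bsub>C\<^esub> z \<in> J"
      by (rule iffD2[OF C.quotient_eq_iff_same_a_r_cos[OF J_ideal x zC] z(1)])
    then have "x \<ominus>\<^bsub>C\<^esub> z \<in> ?Z" by (rule subsetD[OF JZ])
    then have "coset_part L (x \<ominus>\<^bsub>C\<^esub> z) = (\<lambda>D. 0)" and "coset_part L z = (\<lambda>D. 0)"
      using z(2) by (simp_all only: Z)
    then have "coset_part L x j = 0" for j
      unfolding C_minus[OF x zC] part_diff fun_eq_iff by simp
    then show "coset_part L x = (\<lambda>D. 0)" by (rule ext)
  qed
qed

lemma glider_iso:
  "\<exists>\<Phi> \<in> ring_iso D (T Quot I). \<forall>x\<in>carrier C. \<Phi> (coset_parts x) = I +>\<^bsub>T\<^esub> (J +>\<^bsub>C\<^esub> x)"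
  unfolding glider_T_def
proof (rule double_quotient_iso[OF cring.axioms(1)[OF C_cring] J_ideal _ coset_parts_hom coset_parts_surj])
  show "ideal I (C Quot J)" using I_ideal by (simp add: glider_T_def)
  fix x y assume xy: "x \<in> carrier C" "y \<in> carrier C"
  interpret C: cring C by (rule C_cring)
  have "coset_parts x = coset_parts y \<longleftrightarrow> (\<forall>L\<in>proper_subgroups G. coset_part L x = coset_part L y)"
    by (auto simp: coset_parts_def restrict_def fun_eq_iff split: if_splits)
  also have "\<dots> \<longleftrightarrow> (\<forall>L\<in>proper_subgroups G. coset_part L (x \<ominus>\<^bsub>C\<^esub> y) = (\<lambda>D. 0))"
    using xy by (simp add: C_minus part_diff fun_eq_iff)
  also have "\<dots> \<longleftrightarrow> J +>\<^bsub>C\<^esub> (x \<ominus>\<^bsub>C\<^esub> y) \<in> I"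
    using xy by (simp add: kernel)
  finally show "coset_parts x = coset_parts y \<longleftrightarrow> J +>\<^bsub>C\<^esub> (x \<ominus>\<^bsub>C\<^esub> y) \<in> I" .
qed

lemma proj_unit_elem:
  assumes N: "subgroup N G"
  shows "J +>\<^bsub>C\<^esub> unit_elem N = (\<Otimes>\<^bsub>T\<^esub> M \<in> minimal_subgroups (G Mod N).
    glider_proj G H \<pi> (chi (N, \<pi> ` N)) \<ominus>\<^bsub>T\<^esub>
    glider_proj G H \<pi> (chi (subgroup_lift G N M, \<pi> ` subgroup_lift G N M)))"
proof -
  interpret C: cring C by (rule C_cring)
  interpret T: cring T by (rule T_cring)
  interpret p: ring_hom_cring C T "(+>\<^bsub>C\<^esub>) J"
    unfolding glider_T_def by (rule ideal.rcos_ring_hom_cring[OF J_ideal C_cring])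
  let ?S = "minimal_subgroups (G Mod N)"
  have "J +>\<^bsub>C\<^esub> unit_elem N = finprod T
      ((+>\<^bsub>C\<^esub>) J \<circ> (\<lambda>M. gen N \<ominus>\<^bsub>C\<^esub> gen (subgroup_lift G N M))) ?S"
    unfolding unit_elem_def using factor_carrier[OF N] by (subst p.hom_finprod) (auto simp: comp_def)
  also have "\<dots> = (\<Otimes>\<^bsub>T\<^esub> M \<in> ?S. (J +>\<^bsub>C\<^esub> gen N) \<ominus>\<^bsub>T\<^esub> (J +>\<^bsub>C\<^esub> gen (subgroup_lift G N M)))"
    using subgroup_P[OF N] minimal_lift(1)[OF N]
    by (intro T.finprod_cong') (auto simp: a_minus_def gen_carrier)
  finally show ?thesis by (simp add: proj_chi)
qed

end

section \<open>The homomorphism dual to the inclusion of \<open>H\<close>, and the final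
  assembly\<close>

text \<open>After applying \<open>\<psi>\<close>, the map is \<open>\<phi>\<close> followed by
  restriction of characters, both multiplicative; injectivity of \<open>\<psi>\<close> on
  \<open>H\<close> transfers this back.\<close>

lemma dual_restriction_hom:
  assumes "group G" "subgroup H G" "\<phi> \<in> iso G (character_group G)"
    and "\<psi> \<in> iso (G\<lparr>carrier := H\<rparr>) (character_group (G\<lparr>carrier := H\<rparr>))"
  shows "dual_restriction H \<phi> \<psi> \<in> hom G G" "dual_restriction H \<phi> \<psi> ` carrier G \<subseteq> H"
proof -
  let ?\<pi> = "dual_restriction H \<phi> \<psi>" and ?K = "character_group (G\<lparr>carrier := H\<rparr>)"
  interpret group G by fact
  note sub = subgroup.mem_carrier[OF assms(2)] subgroup.m_closed[OF assms(2)]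
  have bij: "bij_betw \<psi> H (carrier ?K)" using assms(4) by (simp add: iso_def)
  have \<phi>: "\<phi> x \<in> hom G nonzero_complex" if "x \<in> carrier G" for x
    using assms(3) that by (auto simp: iso_def hom_def character_group_def)
  have res: "restrict (\<phi> x) H \<in> carrier ?K" if "x \<in> carrier G" for x
    using \<phi>[OF that] sub by (auto simp: character_group_def hom_def)
  \<comment> \<open>Surjectivity of \<open>\<psi>\<close> onto the characters of \<open>H\<close>
    makes \<open>inv_into\<close> a genuine preimage.\<close>
  have mem: "?\<pi> x \<in> H" and \<psi>\<pi>: "\<psi> (?\<pi> x) = restrict (\<phi> x) H" if "x \<in> carrier G" for x
    using res[OF that] bij unfolding dual_restriction_def bij_betw_def
    by (auto intro: inv_into_into f_inv_into_f)
  then show "?\<pi> ` carrier G \<subseteq> H" by auto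
  show "?\<pi> \<in> hom G G"
  proof (rule homI)
    fix x y assume xy: "x \<in> carrier G" "y \<in> carrier G"
    have "\<psi> (?\<pi> x \<otimes>\<^bsub>G\<^esub> ?\<pi> y) = \<psi> (?\<pi> x) \<otimes>\<^bsub>?K\<^esub> \<psi> (?\<pi> y)"
      using assms(4) mem xy by (simp add: iso_def hom_def)
    also have "\<dots> = restrict (\<phi> (x \<otimes>\<^bsub>G\<^esub> y)) H"
      using assms(3) xy sub by (auto simp: \<psi>\<pi> iso_def hom_def character_group_def restrict_def fun_eq_iff)
    also have "\<dots> = \<psi> (?\<pi> (x \<otimes>\<^bsub>G\<^esub> y))" using xy by (simp add: \<psi>\<pi>)
    finally show "?\<pi> (x \<otimes>\<^bsub>G\<^esub> y) = ?\<pi> x \<otimes>\<^bsub>G\<^esub> ?\<pi> y"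
      using bij mem xy sub by (auto simp: bij_betw_def inj_on_def)
  qed (use mem sub in auto)
qed

theorem proposition6p2:
  fixes G :: "('a, 'm) monoid_scheme"
    and H :: "'a set"
    and \<phi> \<psi> :: "'a \<Rightarrow> 'a \<Rightarrow> complex"
    and \<pi> :: "'a \<Rightarrow> 'a"
  assumes "comm_group G" and "finite (carrier G)" and "subgroup H G"
    and "\<phi> \<in> iso G (character_group G)"
    and "\<psi> \<in> iso (G\<lparr>carrier := H\<rparr>) (character_group (G\<lparr>carrier := H\<rparr>))"
    and "\<pi> = dual_restriction H \<phi> \<psi>"
  shows "\<exists>\<Phi> \<in> ring_iso
      (direct_sum_ring (proper_subgroups G) (\<lambda>N. group_algebra (G Mod N)))
      (glider_T G H \<pi> Quot glider_ideal G H \<pi>).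
    \<forall>N \<in> proper_subgroups G.
      \<Phi> (component_unit (proper_subgroups G) (\<lambda>N. group_algebra (G Mod N)) N) =
        glider_ideal G H \<pi> +>\<^bsub>glider_T G H \<pi>\<^esub>
          (\<Otimes>\<^bsub>glider_T G H \<pi>\<^esub> M \<in> minimal_subgroups (G Mod N).
             glider_proj G H \<pi> (chi (N, \<pi> ` N)) \<ominus>\<^bsub>glider_T G H \<pi>\<^esub>
             glider_proj G H \<pi> (chi (subgroup_lift G N M, \<pi> ` subgroup_lift G N M)))"
proof -
  interpret comm_group G by fact
  interpret glider_chain G H \<pi>
    using assms dual_restriction_hom[OF is_group assms(3-5)]
    by (intro glider_chain.intro glider_chain_axioms.intro) auto
  obtain \<Phi> where \<Phi>: "\<Phi> \<in> ring_iso D (T Quot I)"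
    "\<And>x. x \<in> carrier C \<Longrightarrow> \<Phi> (coset_parts x) = I +>\<^bsub>T\<^esub> (J +>\<^bsub>C\<^esub> x)"
    using glider_iso by blast
  show ?thesis
  proof (intro bexI[OF _ \<Phi>(1)] ballI)
    fix N assume N: "N \<in> proper_subgroups G"
    then have sub: "subgroup N G" by (simp add: proper_subgroups_def)
    \<comment> \<open>Both sides come from \<open>unit_elem N\<close>: its image in the direct sum
      is the component unit, and its class in \<open>T\<close> is the prescribed product.\<close>
    show "\<Phi> (component_unit (proper_subgroups G) (\<lambda>N. group_algebra (G Mod N)) N) =
        I +>\<^bsub>T\<^esub> (\<Otimes>\<^bsub>T\<^esub> M \<in> minimal_subgroups (G Mod N).
          glider_proj G H \<pi> (chi (N, \<pi> ` N)) \<ominus>\<^bsub>T\<^esub>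
          glider_proj G H \<pi> (chi (subgroup_lift G N M, \<pi> ` subgroup_lift G N M)))"
      using \<Phi>(2)[OF unit_elem_carrier[OF sub]]
      by (simp add: coset_parts_unit_elem[OF N] proj_unit_elem[OF sub])
  qed
qed

end
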